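(* Let $1\leqslant r<\infty$ and let $(g_n)_{n=1}^\infty$ be a normalized, bimonotone, $r$-right dominant Schauder basis. Let $X$ be a Banach space, let $(R,\|\cdot\|_R)$ be a subsequential space on $X$, and let $\Gamma(\xi,\varrho)$ and $\Gamma(\xi)$ (for $\xi\leqslant\omega_1$, $\varrho\in R$) be the associated quantities defined in the context. Fix an ordinal $\zeta\leqslant \omega_1$. If $\Gamma(\zeta, \varrho)<\infty$ for each $\varrho\in R$, then $\Gamma(\zeta)<\infty$.
   Context: Right dominance: a Schauder basis $(g_n)_{n=1}^\infty$ is $r$-right dominant if for any sequences $m_1<m_2<\ldots$ and $l_1<l_2<\ldots$ of positive integers with $m_n\leqslant l_n$ for all $n$, $\|\sum_n a_n g_{m_n}\|\leqslant r\|\sum_n a_n g_{l_n}\|$ for all finitely supported scalar sequences $(a_n)$. Bimonotone means that all basis projections onto intervals of $\mathbb{N}$ have norm at most $1$. Subsequential space: for a Banach space $X$, a subsequential space on $X$ is a (not necessarily closed) linear subspace $R$ of $\ell_\infty(X)$ (bounded sequences in $X$, sup norm) with $c_{00}(X)\subset R$, endowed with a norm $\|\cdot\|_R$ such that, with $B_R$ denoting its closed unit ball: (i) $(R,\|\cdot\|_R)$ is a Banach space; (ii) any subsequence of a member of $B_R$ is a member of $B_R$; (iii) $B_R\subset B_{\ell_\infty(X)}$. Sets: subsets of $\mathbb{N}$ are identified with strictly increasing sequences. $[\mathbb{N}]$ and $[\mathbb{N}]^{<\omega}$ denote the sets of infinite and finite subsets of $\mathbb{N}$. For $M\in[\mathbb{N}]$,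 $M(n)$ is the $n$th smallest element of $M$, and $M(F)=(M(n):n\in F)$ for $F\subset\mathbb{N}$. For $n\in\mathbb{N}$, $n\leqslant F$ (resp. $n<F$) means $n\leqslant\min F$ (resp. $n<\min F$), with $\min\varnothing=\infty$. Fine Schreier families: $\mathcal{F}_0=\{\varnothing\}$; $\mathcal{F}_{\xi+1}=\{\varnothing\}\cup\{\{n\}\cup F: n<F\in\mathcal{F}_\xi\}$; for a countable limit ordinal $\xi$, a sequence of ordinals $\xi_n\uparrow\xi$ is fixed and $\mathcal{F}_\xi=\{F:\exists n\leqslant F\in\mathcal{F}_{\xi_n}\}$ (i.e. there is $n$ with $n\leqslant F$ and $F\in\mathcal{F}_{\xi_n}$). Also $\mathcal{F}_{\omega_1}=[\mathbb{N}]^{<\omega}$. The quantities $\Gamma$: for finite sequences, $(x_n)_{n=1}^t\leqslant_C(y_n)_{n=1}^t$ means $\|\sum_{n=1}^t a_nx_n\|\leqslant C\|\sum_{n=1}^t a_ny_n\|$ for all scalars $(a_n)_{n=1}^t$. For $\varrho=(x_n)_{n=1}^\infty\in R$ and $0<C<\infty$, let $T(\varrho,C)$ consist of the empty sequence and all finite sequences $(m_n,l_n)_{n=1}^t$ in $\mathbb{N}\times\mathbb{N}$ with $m_1<\ldots<m_t$, $l_1<\ldots<l_t$ and $(x_{m_n})_{n=1}^t\leqslant_C(g_{l_n})_{n=1}^t$. The pair $(M(F),L(F))$ is identified with the sequence $(M(n),L(n))_{n\in F}$. For $\xi\leqslant\omega_1$ and $\varrho\in R$, $\Gamma(\xi,\varrho)$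 is the infimum of those $C>0$ for which there exist $M,L\in[\mathbb{N}]$ with $\{(M(F),L(F)):F\in\mathcal{F}_\xi\}\subset T(\varrho,C)$, and $\Gamma(\xi,\varrho)=\infty$ if no such $C$ exists. Finally $\Gamma(\xi)=\sup_{\varrho\in B_R}\Gamma(\xi,\varrho)$. *)

theory Defs
  imports "HOL-Analysis.Analysis" "HOL-Library.Countable_Set_Type"
begin

text \<open>
  Throughout, the positive integers are represented by the type \<^typ>\<open>nat\<close> via the order
  isomorphism that sends \<open>k\<close> to \<open>k - 1\<close>; nothing below uses more of the positive integers than
  their order. In particular \<open>M(n)\<close> is \<open>enumerate M n\<close>, which is the \<open>n\<close>-th smallest element of
  \<open>M\<close> with counting started at \<open>0\<close>.
\<close>


section \<open>Ordinals up to the first uncountable ordinal\<close>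

text \<open>The countable ordinals: \<^term>\<open>cardSuc natLeq\<close> is a well-order of type \<open>\<omega>\<^sub>1\<close>.\<close>

typedef countable_ord = "Field (cardSuc natLeq)"
proof -
  have "infinite (Field (cardSuc natLeq))"
    using cardSuc_finite[OF natLeq_Card_order] by (simp add: Field_natLeq)
  then show ?thesis
    by (metis equals0I finite.emptyI)
qed

lemma Well_order_cardSuc_natLeq: "Well_order (cardSuc natLeq)"
  using cardSuc_Card_order[OF natLeq_Card_order] by (simp add: card_order_on_well_order_on)

instantiation countable_ord :: wellorder
begin

definition less_eq_countable_ord :: "countable_ord \<Rightarrow> countable_ord \<Rightarrow> bool" where
  "x \<le> y \<longleftrightarrow> (Rep_countable_ord x, Rep_countable_ord y) \<in> cardSuc natLeq"

definition less_countable_ord :: "countable_ord \<Rightarrow> countable_ord \<Rightarrow> bool" where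
  "x < y \<longleftrightarrow> x \<le> y \<and> x \<noteq> (y :: countable_ord)"

instance
proof
  let ?r = "cardSuc natLeq"
  have ref: "refl_on (Field ?r) ?r" and tr: "trans ?r" and anti: "antisym ?r"
    and tot: "total_on (Field ?r) ?r" and wf: "wf (?r - Id)"
    using Well_order_cardSuc_natLeq
    by (auto simp: well_order_on_def linear_order_on_def partial_order_on_def preorder_on_def)
  note R = Rep_countable_ord
  show antisym': "x = y" if "x \<le> y" "y \<le> x" for x y :: countable_ord
    using that antisymD[OF anti] by (auto simp: less_eq_countable_ord_def simp flip: Rep_countable_ord_inject)
  show "x < y \<longleftrightarrow> x \<le> y \<and> \<not> y \<le> x" for x y :: countable_ord
    using antisym' ref R by (auto simp: less_countable_ord_def less_eq_countable_ord_def refl_on_def)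
  show "x \<le> x" for x :: countable_ord
    using ref R by (auto simp: less_eq_countable_ord_def refl_on_def)
  show "x \<le> z" if "x \<le> y" "y \<le> z" for x y z :: countable_ord
    using that tr unfolding less_eq_countable_ord_def trans_def by blast
  show "x \<le> y \<or> y \<le> x" for x y :: countable_ord
    using tot ref R[of x] R[of y]
    unfolding less_eq_countable_ord_def total_on_def refl_on_def by metis
  show "P a" if step: "\<And>x. (\<And>y. y < x \<Longrightarrow> P y) \<Longrightarrow> P x" for P and a :: countable_ord
  proof -
    have "wf (inv_image (?r - Id) Rep_countable_ord)"
      using wf by (rule wf_inv_image)
    then show "P a"
    proof (induction a rule: wf_induct_rule)
      case (less x)
      show ?case
      proof (rule step)
        fix y :: countable_ord assume "y < x"
        then have "(y, x) \<in> inv_image (?r - Id) Rep_countable_ord"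
          by (auto simp: less_countable_ord_def less_eq_countable_ord_def Rep_countable_ord_inject)
        then show "P y" by (rule less)
      qed
    qed
  qed
qed

end

text \<open>The next two lemmas characterize \<open>\<omega>\<^sub>1\<close> up to order isomorphism.\<close>

lemma uncountable_UNIV_countable_ord: "uncountable (UNIV :: countable_ord set)"
proof
  assume "countable (UNIV :: countable_ord set)"
  then have "countable (Rep_countable_ord ` UNIV)" by (rule countable_image)
  then have "countable (Field (cardSuc natLeq))"
    using type_definition.Rep_range[OF type_definition_countable_ord] by simp
  then have "(card_of (Field (cardSuc natLeq)), natLeq) \<in> ordLeq"
    by (simp add: countable_card_le_natLeq)
  then have "(cardSuc natLeq, natLeq) \<in> ordLeq"
    using card_of_Field_ordIso[OF cardSuc_Card_order[OF natLeq_Card_order]]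
    by (meson ordIso_ordLeq_trans ordIso_symmetric)
  then show False
    using cardSuc_greater[OF natLeq_Card_order] not_ordLess_ordLeq by blast
qed

lemma countable_lessThan_countable_ord: "countable {..<x :: countable_ord}"
proof -
  let ?r = "cardSuc natLeq"
  have "(card_of (underS ?r (Rep_countable_ord x)), ?r) \<in> ordLess"
    using cardSuc_Card_order[OF natLeq_Card_order] Rep_countable_ord[of x]
    by (rule card_of_underS)
  then have "(card_of (underS ?r (Rep_countable_ord x)), natLeq) \<in> ordLeq"
    using cardSuc_ordLeq_ordLess[OF natLeq_Card_order card_of_Card_order] by blast
  then have "countable (underS ?r (Rep_countable_ord x))"
    by (simp add: countable_card_le_natLeq)
  moreover have "Rep_countable_ord ` {..<x} \<subseteq> underS ?r (Rep_countable_ord x)"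
    by (auto simp: underS_def less_countable_ord_def less_eq_countable_ord_def
        Rep_countable_ord_inject)
  ultimately have "countable (Rep_countable_ord ` {..<x})"
    by (meson countable_subset)
  then show ?thesis
    by (rule countable_image_inj_on) (auto simp: inj_on_def Rep_countable_ord_inject)
qed

lemma ex_greater_countable_ord: "\<exists>y. x < (y :: countable_ord)"
proof (rule ccontr)
  assume "\<nexists>y. x < y"
  then have "UNIV = insert x {..<x}" by (auto simp: not_less order.order_iff_strict)
  then show False
    using uncountable_UNIV_countable_ord countable_lessThan_countable_ord[of x]
    by (metis countable_insert)
qed

definition zero_ord :: countable_ord where
  "zero_ord = (LEAST x. True)"

definition succ_ord :: "countable_ord \<Rightarrow> countable_ord" where
  "succ_ord x = (LEAST y. x < y)"

definition limit_ord :: "countable_ord \<Rightarrow> bool" where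
  "limit_ord x \<longleftrightarrow> x \<noteq> zero_ord \<and> (\<forall>y. x \<noteq> succ_ord y)"

lemma less_succ_ord: "x < succ_ord x"
  unfolding succ_ord_def by (rule LeastI_ex[OF ex_greater_countable_ord])

lemma succ_ord_le_iff: "succ_ord x \<le> y \<longleftrightarrow> x < y"
  using less_succ_ord[of x] Least_le[of "\<lambda>y. x < y" y] unfolding succ_ord_def
  by (auto intro: less_le_trans)

lemma succ_ord_inject: "succ_ord x = succ_ord y \<longleftrightarrow> x = y"
  by (metis less_succ_ord succ_ord_le_iff leD linorder_neqE)

lemma zero_ord_le: "zero_ord \<le> x"
  unfolding zero_ord_def by (rule Least_le) simp

lemma succ_ord_neq_zero: "succ_ord x \<noteq> zero_ord"
  using less_succ_ord[of x] zero_ord_le[of x] by auto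

text \<open>The ordinals \<open>\<xi> \<le> \<omega>\<^sub>1\<close>.\<close>

datatype ord_upto_omega1 = Countable_ord countable_ord | Omega1


section \<open>Fine Schreier families\<close>

text \<open>
  \<open>fs \<xi> n\<close> is the \<open>n\<close>-th member of the sequence \<open>\<xi>\<^sub>n \<up> \<xi>\<close> fixed for the limit ordinal \<open>\<xi>\<close>.
  Strictly increasing sequences are included; values at non-limit ordinals are irrelevant.
\<close>

definition fundamental_sequences :: "(countable_ord \<Rightarrow> nat \<Rightarrow> countable_ord) \<Rightarrow> bool" where
  "fundamental_sequences fs \<longleftrightarrow>
     (\<forall>\<xi>. limit_ord \<xi> \<longrightarrow>
        mono (fs \<xi>) \<and> (\<forall>n. fs \<xi> n < \<xi>) \<and> (\<forall>\<eta><\<xi>. \<exists>n. \<eta> < fs \<xi> n))"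

text \<open>
  The transfinite recursion is written as an inductive definition; the recursion equations are
  the lemmas \<open>fine_schreier_zero\<close>, \<open>fine_schreier_succ\<close> and \<open>fine_schreier_limit\<close> below.
\<close>

inductive fine_schreier_mem ::
  "(countable_ord \<Rightarrow> nat \<Rightarrow> countable_ord) \<Rightarrow> countable_ord \<Rightarrow> nat set \<Rightarrow> bool"
  for fs where
  zero: "fine_schreier_mem fs zero_ord {}"
| succ_empty: "fine_schreier_mem fs (succ_ord \<xi>) {}"
| succ_insert: "fine_schreier_mem fs \<xi> F \<Longrightarrow> (\<And>k. k \<in> F \<Longrightarrow> n < k) \<Longrightarrow>
    fine_schreier_mem fs (succ_ord \<xi>) (insert n F)"
| limit: "limit_ord \<xi> \<Longrightarrow> fine_schreier_mem fs (fs \<xi> n) F \<Longrightarrow> (\<And>k. k \<in> F \<Longrightarrow> n \<le> k) \<Longrightarrow>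
    fine_schreier_mem fs \<xi> F"

fun fine_schreier ::
  "(countable_ord \<Rightarrow> nat \<Rightarrow> countable_ord) \<Rightarrow> ord_upto_omega1 \<Rightarrow> nat set set" where
  "fine_schreier fs (Countable_ord \<xi>) = {F. fine_schreier_mem fs \<xi> F}"
| "fine_schreier fs Omega1 = {F. finite F}"

lemma fine_schreier_zero: "fine_schreier fs (Countable_ord zero_ord) = {{}}"
proof -
  have "F = {}" if "fine_schreier_mem fs zero_ord F" for F
    using that
    by cases (use succ_ord_neq_zero in \<open>auto simp: limit_ord_def dest: sym\<close>)
  then show ?thesis by (auto intro: fine_schreier_mem.intros)
qed

lemma fine_schreier_succ:
  "fine_schreier fs (Countable_ord (succ_ord \<xi>)) =
     {{}} \<union> {{n} \<union> F |n F. (\<forall>k\<in>F. n < k) \<and> F \<in> fine_schreier fs (Countable_ord \<xi>)}"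
  (is "?A = ?B")
proof
  show "?A \<subseteq> ?B"
  proof
    fix G assume "G \<in> ?A"
    then have "fine_schreier_mem fs (succ_ord \<xi>) G" by simp
    then show "G \<in> ?B"
    proof cases
      case (succ_insert \<eta> F n)
      then show ?thesis by (auto simp: succ_ord_inject)
    qed (auto simp: limit_ord_def)
  qed
  show "?B \<subseteq> ?A"
    by (auto intro: fine_schreier_mem.intros)
qed

lemma fine_schreier_limit:
  assumes "limit_ord \<xi>"
  shows "fine_schreier fs (Countable_ord \<xi>) =
     {F. \<exists>n. (\<forall>k\<in>F. n \<le> k) \<and> F \<in> fine_schreier fs (Countable_ord (fs \<xi> n))}"
proof -
  have "\<exists>n. (\<forall>k\<in>F. n \<le> k) \<and> fine_schreier_mem fs (fs \<xi> n) F"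
    if "fine_schreier_mem fs \<xi> F" for F
    using that by cases (use assms in \<open>auto simp: limit_ord_def\<close>)
  then show ?thesis using assms by (auto intro: fine_schreier_mem.limit)
qed


section \<open>Normed spaces over the real or complex scalars\<close>

text \<open>
  The scalar field \<open>'k\<close> is real or complex: up to isomorphism these are the only fields of
  class \<^class>\<open>real_normed_field\<close>. The class \<^class>\<open>banach\<close> only provides the real structure of a
  Banach space; the multiplication by scalars from \<open>'k\<close> is the parameter \<open>smul\<close>, which extends
  the real one. A real Banach space is the case \<open>smul = scaleR\<close>.
\<close>

locale normed_space_over = vector_space smul
  for smul :: "'k::real_normed_field \<Rightarrow> 'a::real_normed_vector \<Rightarrow> 'a" +
  assumes norm_scale: "norm (smul c x) = norm c * norm x"
    and scale_of_real: "smul (of_real t) x = t *\<^sub>R x"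


section \<open>Schauder bases\<close>

definition schauder_basis ::
  "('k::real_normed_field \<Rightarrow> 'a::real_normed_vector \<Rightarrow> 'a) \<Rightarrow> (nat \<Rightarrow> 'a) \<Rightarrow> bool" where
  "schauder_basis smul g \<longleftrightarrow> (\<forall>x. \<exists>!a :: nat \<Rightarrow> 'k. (\<lambda>n. smul (a n) (g n)) sums x)"

definition basis_coeff ::
  "('k::real_normed_field \<Rightarrow> 'a::real_normed_vector \<Rightarrow> 'a) \<Rightarrow> (nat \<Rightarrow> 'a) \<Rightarrow> 'a \<Rightarrow> nat \<Rightarrow> 'k" where
  "basis_coeff smul g x = (THE a. (\<lambda>n. smul (a n) (g n)) sums x)"

definition basis_proj ::
  "('k::real_normed_field \<Rightarrow> 'a::real_normed_vector \<Rightarrow> 'a) \<Rightarrow> (nat \<Rightarrow> 'a) \<Rightarrow> nat set \<Rightarrow> 'a \<Rightarrow> 'a" where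
  "basis_proj smul g I x = (\<Sum>n. if n \<in> I then smul (basis_coeff smul g x n) (g n) else 0)"

definition nat_interval :: "nat set \<Rightarrow> bool" where
  "nat_interval I \<longleftrightarrow> (\<forall>a\<in>I. \<forall>b\<in>I. {a..b} \<subseteq> I)"

definition bimonotone ::
  "('k::real_normed_field \<Rightarrow> 'a::real_normed_vector \<Rightarrow> 'a) \<Rightarrow> (nat \<Rightarrow> 'a) \<Rightarrow> bool" where
  "bimonotone smul g \<longleftrightarrow> (\<forall>I. nat_interval I \<longrightarrow> (\<forall>x. norm (basis_proj smul g I x) \<le> norm x))"

definition right_dominant ::
  "real \<Rightarrow> ('k::real_normed_field \<Rightarrow> 'a::real_normed_vector \<Rightarrow> 'a) \<Rightarrow> (nat \<Rightarrow> 'a) \<Rightarrow> bool" where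
  "right_dominant r smul g \<longleftrightarrow>
     (\<forall>m l :: nat \<Rightarrow> nat. strict_mono m \<and> strict_mono l \<and> (\<forall>n. m n \<le> l n) \<longrightarrow>
       (\<forall>a :: nat \<Rightarrow> 'k. finite {n. a n \<noteq> 0} \<longrightarrow>
          norm (\<Sum>n | a n \<noteq> 0. smul (a n) (g (m n)))
            \<le> r * norm (\<Sum>n | a n \<noteq> 0. smul (a n) (g (l n)))))"


section \<open>Subsequential spaces\<close>

text \<open>\<open>nrm\<close> is the norm of \<open>R\<close>; its values outside \<open>R\<close> are irrelevant.\<close>

definition unit_ball :: "(nat \<Rightarrow> 'a) set \<Rightarrow> ((nat \<Rightarrow> 'a) \<Rightarrow> real) \<Rightarrow> (nat \<Rightarrow> 'a) set" where
  "unit_ball R nrm = {x \<in> R. nrm x \<le> 1}"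

locale subsequential_space = normed_space_over smul
  for smul :: "'k::real_normed_field \<Rightarrow> 'a::banach \<Rightarrow> 'a"
    and R :: "(nat \<Rightarrow> 'a) set"
    and nrm :: "(nat \<Rightarrow> 'a) \<Rightarrow> real" +
  assumes bounded_seq: "x \<in> R \<Longrightarrow> bounded (range x)"
    and c00_subset: "finite {n. x n \<noteq> 0} \<Longrightarrow> x \<in> R"
    and add_mem: "x \<in> R \<Longrightarrow> y \<in> R \<Longrightarrow> (\<lambda>n. x n + y n) \<in> R"
    and scale_mem: "x \<in> R \<Longrightarrow> (\<lambda>n. smul c (x n)) \<in> R"
    and nrm_nonneg: "x \<in> R \<Longrightarrow> 0 \<le> nrm x"
    and nrm_eq_0: "x \<in> R \<Longrightarrow> nrm x = 0 \<longleftrightarrow> x = (\<lambda>n. 0)"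
    and nrm_triangle: "x \<in> R \<Longrightarrow> y \<in> R \<Longrightarrow> nrm (\<lambda>n. x n + y n) \<le> nrm x + nrm y"
    and nrm_scale: "x \<in> R \<Longrightarrow> nrm (\<lambda>n. smul c (x n)) = norm c * nrm x"
    and nrm_complete: "(\<And>i. s i \<in> R) \<Longrightarrow>
      (\<And>e. 0 < e \<Longrightarrow> \<exists>N. \<forall>i\<ge>N. \<forall>j\<ge>N. nrm (\<lambda>n. s i n - s j n) < e) \<Longrightarrow>
      \<exists>x\<in>R. (\<lambda>i. nrm (\<lambda>n. s i n - x n)) \<longlonglongrightarrow> 0"
    and subseq_mem_ball: "x \<in> unit_ball R nrm \<Longrightarrow> strict_mono k \<Longrightarrow> x \<circ> k \<in> unit_ball R nrm"
    and ball_subset: "x \<in> unit_ball R nrm \<Longrightarrow> norm (x n) \<le> 1"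


section \<open>The quantities \<open>\<Gamma>\<close>\<close>

definition dominated ::
  "('k::real_normed_field \<Rightarrow> 'a::real_normed_vector \<Rightarrow> 'a) \<Rightarrow>
   ('k \<Rightarrow> 'b::real_normed_vector \<Rightarrow> 'b) \<Rightarrow> real \<Rightarrow> 'a list \<Rightarrow> 'b list \<Rightarrow> bool" where
  "dominated scaleX scaleG C xs ys \<longleftrightarrow>
     length xs = length ys \<and>
     (\<forall>a :: nat \<Rightarrow> 'k. norm (\<Sum>n<length xs. scaleX (a n) (xs ! n))
        \<le> C * norm (\<Sum>n<length ys. scaleG (a n) (ys ! n)))"

definition dom_tree ::
  "('k::real_normed_field \<Rightarrow> 'a::real_normed_vector \<Rightarrow> 'a) \<Rightarrow>
   ('k \<Rightarrow> 'b::real_normed_vector \<Rightarrow> 'b) \<Rightarrow> (nat \<Rightarrow> 'b) \<Rightarrow> (nat \<Rightarrow> 'a) \<Rightarrow> real \<Rightarrow> (nat \<times> nat) list set"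
  where
  "dom_tree scaleX scaleG g \<rho> C = insert []
     {s. sorted_wrt (<) (map fst s) \<and> sorted_wrt (<) (map snd s) \<and>
         dominated scaleX scaleG C (map (\<lambda>(m, l). \<rho> m) s) (map (\<lambda>(m, l). g l) s)}"

definition pair_seq :: "nat set \<Rightarrow> nat set \<Rightarrow> nat set \<Rightarrow> (nat \<times> nat) list" where
  "pair_seq M L F = map (\<lambda>n. (enumerate M n, enumerate L n)) (sorted_list_of_set F)"

text \<open>In \<^typ>\<open>ereal\<close> the infimum of the empty set is \<open>\<infinity>\<close>.\<close>

definition Gamma_at ::
  "('k::real_normed_field \<Rightarrow> 'a::real_normed_vector \<Rightarrow> 'a) \<Rightarrow>
   ('k \<Rightarrow> 'b::real_normed_vector \<Rightarrow> 'b) \<Rightarrow> (nat \<Rightarrow> 'b) \<Rightarrow>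
   (countable_ord \<Rightarrow> nat \<Rightarrow> countable_ord) \<Rightarrow> ord_upto_omega1 \<Rightarrow> (nat \<Rightarrow> 'a) \<Rightarrow> ereal" where
  "Gamma_at scaleX scaleG g fs \<xi> \<rho> =
     Inf {ereal C |C. 0 < C \<and>
       (\<exists>M L. infinite M \<and> infinite L \<and>
          {pair_seq M L F |F. F \<in> fine_schreier fs \<xi>} \<subseteq> dom_tree scaleX scaleG g \<rho> C)}"

definition Gamma_sup ::
  "('k::real_normed_field \<Rightarrow> 'a::real_normed_vector \<Rightarrow> 'a) \<Rightarrow>
   ('k \<Rightarrow> 'b::real_normed_vector \<Rightarrow> 'b) \<Rightarrow> (nat \<Rightarrow> 'b) \<Rightarrow>
   (countable_ord \<Rightarrow> nat \<Rightarrow> countable_ord) \<Rightarrow>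
   (nat \<Rightarrow> 'a) set \<Rightarrow> ((nat \<Rightarrow> 'a) \<Rightarrow> real) \<Rightarrow> ord_upto_omega1 \<Rightarrow> ereal" where
  "Gamma_sup scaleX scaleG g fs R nrm \<xi> = (SUP \<rho>\<in>unit_ball R nrm. Gamma_at scaleX scaleG g fs \<xi> \<rho>)"

end

theory Submission
  imports Defs
begin

text \<open>
  The theorem is a uniform boundedness principle for the quantities \<open>\<Gamma>\<close>. For a fixed ordinal a
  gliding hump argument needs, at each step, control of the terms chosen later, and these have small
  norm in \<open>R\<close> but no a priori small \<open>\<Gamma>\<close>. The control comes from smaller ordinals, by induction:

    \<^item> Passing from \<open>\<xi>\<close> to \<open>\<xi> + 1\<close> raises \<open>\<Gamma>(\<xi>, \<rho>)\<close> by at most \<open>1\<close> for \<open>\<rho>\<close> in the unit ball, since the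
      basis is bimonotone (\<open>dom_along_succ\<close>).
    \<^item> If \<open>\<zeta>\<close> is a limit ordinal or \<open>\<omega>\<^sub>1\<close>, a large value of \<open>\<Gamma>(\<zeta>, \<rho>)\<close> is already witnessed, up to the
      factor \<open>r\<close>, by some \<open>\<xi> < \<zeta>\<close> after passing to a subsequence of \<open>\<rho>\<close>. For limit ordinals this
      is a diagonal argument (\<open>dom_along_limit\<close>); for \<open>\<omega>\<^sub>1\<close> it says that a tree on a countable set
      whose rank is at least \<open>\<omega>\<^sub>1\<close> has an infinite branch (\<open>dom_along_finite_sets\<close>).
    \<^item> By induction \<open>\<Gamma>(\<xi>)\<close> is finite for this \<open>\<xi>\<close>, so a tail of small norm has small \<open>\<Gamma>(\<xi>, _)\<close>, and the
      gliding hump goes through when the \<open>n\<close>-th term is tested at its own ordinal \<open>\<xi>\<close>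
      (\<open>uniform_boundedness\<close>).

  The index sets \<open>M\<close> and \<open>L\<close> in the definition of \<open>\<Gamma>\<close> depend on the vector. Finitely many vectors are
  brought to common index sets in two ways. On the side of \<open>M\<close>, every \<open>\<rho> \<in> R\<close> has a subsequence all of
  whose subsequences obey one bound (\<open>hereditary_bound\<close>), so that refining \<open>M\<close> for the sake of another
  vector is harmless. On the side of \<open>L\<close>, right dominance allows moving to the maximum at the cost of
  the factor \<open>r\<close> (\<open>dom_along_add\<close>).
\<close>

section \<open>Combinatorics of the fine Schreier families\<close>

definition spreading :: "nat set set \<Rightarrow> bool" where
  "spreading \<F> \<longleftrightarrow> (\<forall>F\<in>\<F>. \<forall>h. strict_mono h \<longrightarrow> h ` F \<in> \<F>)"

lemma fine_schreier_mem_spread: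
  assumes "fine_schreier_mem fs \<xi> F" "strict_mono h"
  shows "fine_schreier_mem fs \<xi> (h ` F)"
  using assms
proof (induction rule: fine_schreier_mem.induct)
  case (succ_insert \<xi> F n)
  then show ?case
    by (auto intro!: fine_schreier_mem.succ_insert simp: strict_mono_less)
next
  case (limit \<xi> n F)
  have "n \<le> h k" if "k \<in> F" for k
    using limit.hyps(3)[OF that] strict_mono_imp_increasing[OF limit.prems, of k] by simp
  then show ?case
    using limit by (auto intro: fine_schreier_mem.limit)
qed (auto intro: fine_schreier_mem.intros)

lemma fine_schreier_mem_subset:
  assumes "fine_schreier_mem fs \<xi> F" "G \<subseteq> F"
  shows "fine_schreier_mem fs \<xi> G"
  using assms
proof (induction arbitrary: G rule: fine_schreier_mem.induct)
  case (succ_insert \<xi> F n)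
  have *: "fine_schreier_mem fs \<xi> (G - {n})"
    using succ_insert.prems by (intro succ_insert.IH) auto
  show ?case
  proof (cases "n \<in> G")
    case True
    have "fine_schreier_mem fs (succ_ord \<xi>) (insert n (G - {n}))"
      by (rule fine_schreier_mem.succ_insert[OF *]) (use succ_insert in auto)
    then show ?thesis using True by (simp add: insert_absorb)
  next
    case False
    show ?thesis
    proof (cases "G = {}")
      case True
      then show ?thesis by (simp add: fine_schreier_mem.succ_empty)
    next
      case nonempty: False
      define m where "m = (LEAST k. k \<in> G)"
      have m: "m \<in> G" "\<And>k. k \<in> G \<Longrightarrow> m \<le> k"
        using nonempty unfolding m_def by (auto intro: LeastI Least_le)
      have "fine_schreier_mem fs \<xi> (G - {m})"
        using succ_insert.prems False by (intro succ_insert.IH) auto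
      then have "fine_schreier_mem fs (succ_ord \<xi>) (insert m (G - {m}))"
        by (rule fine_schreier_mem.succ_insert) (use m in \<open>auto simp: order.strict_iff_order\<close>)
      then show ?thesis using m by (simp add: insert_absorb)
    qed
  qed
qed (auto intro: fine_schreier_mem.intros)

lemma fine_schreier_mem_finite: "fine_schreier_mem fs \<xi> F \<Longrightarrow> finite F"
  by (induction rule: fine_schreier_mem.induct) auto

lemma fine_schreier_mem_succ:
  assumes "fine_schreier_mem fs \<xi> F"
  shows "fine_schreier_mem fs (succ_ord \<xi>) F"
proof (cases "F = {}")
  case True
  then show ?thesis by (simp add: fine_schreier_mem.succ_empty)
next
  case False
  define m where "m = (LEAST k. k \<in> F)"
  have m: "m \<in> F" "\<And>k. k \<in> F \<Longrightarrow> m \<le> k"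
    using False unfolding m_def by (auto intro: LeastI Least_le)
  have "fine_schreier_mem fs \<xi> (F - {m})"
    using assms by (rule fine_schreier_mem_subset) auto
  then have "fine_schreier_mem fs (succ_ord \<xi>) (insert m (F - {m}))"
    by (rule fine_schreier_mem.succ_insert) (use m in \<open>auto simp: order.strict_iff_order\<close>)
  then show ?thesis using m by (simp add: insert_absorb)
qed

text \<open>
  At a limit ordinal \<open>\<xi>\<close> a set of lower rank becomes a member of the \<open>\<xi>\<close>-th family only once its
  minimum exceeds the index of a term of the fundamental sequence; these finitely many thresholds
  met on the way from \<open>\<eta>\<close> to \<open>\<xi>\<close> are why the families increase only up to an initial segment.
\<close>

lemma fine_schreier_mem_almost_mono:
  assumes "fundamental_sequences fs" "\<eta> \<le> \<xi>"
  shows "\<exists>n. \<forall>F. fine_schreier_mem fs \<eta> F \<longrightarrow> (\<forall>i\<in>F. n \<le> i) \<longrightarrow> fine_schreier_mem fs \<xi> F"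
  using assms(2)
proof (induction \<xi> rule: less_induct)
  case (less \<xi>)
  consider "\<eta> = \<xi>" | "\<eta> < \<xi>" "\<xi> = zero_ord" | \<xi>' where "\<eta> < \<xi>" "\<xi> = succ_ord \<xi>'" | "\<eta> < \<xi>" "limit_ord \<xi>"
    using less.prems unfolding limit_ord_def by fastforce
  then show ?case
  proof cases
    case 1
    then show ?thesis by auto
  next
    case 2
    then show ?thesis using zero_ord_le[of \<eta>] by simp
  next
    case (3 \<xi>')
    have "\<eta> \<le> \<xi>'" using 3 succ_ord_le_iff[of \<xi>' \<eta>] by (auto simp: not_le[symmetric])
    then obtain n where "\<forall>F. fine_schreier_mem fs \<eta> F \<longrightarrow> (\<forall>i\<in>F. n \<le> i) \<longrightarrow> fine_schreier_mem fs \<xi>' F"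
      using less.IH[of \<xi>'] less_succ_ord[of \<xi>'] 3 by auto
    then show ?thesis using 3 fine_schreier_mem_succ by blast
  next
    case 4
    then obtain k where k: "\<eta> < fs \<xi> k" "fs \<xi> k < \<xi>"
      using assms(1) unfolding fundamental_sequences_def by blast
    then obtain n where "\<forall>F. fine_schreier_mem fs \<eta> F \<longrightarrow> (\<forall>i\<in>F. n \<le> i) \<longrightarrow> fine_schreier_mem fs (fs \<xi> k) F"
      using less.IH[of "fs \<xi> k"] by (meson less_imp_le)
    then have "\<forall>F. fine_schreier_mem fs \<eta> F \<longrightarrow> (\<forall>i\<in>F. max n k \<le> i) \<longrightarrow> fine_schreier_mem fs \<xi> F"
      using 4 by (auto intro!: fine_schreier_mem.limit[of \<xi> fs k])
    then show ?thesis by blast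
  qed
qed

lemma spreading_fine_schreier: "spreading (fine_schreier fs \<xi>)"
  by (cases \<xi>) (auto simp: spreading_def fine_schreier_mem_spread)

lemma finite_fine_schreier: "F \<in> fine_schreier fs \<xi> \<Longrightarrow> finite F"
  by (cases \<xi>) (auto dest: fine_schreier_mem_finite)

text \<open>
  The pigeonhole principle that makes \<open>\<omega>\<^sub>1\<close> special: if every \<open>p\<close> failed from some \<open>b p\<close> on, then
  countably many initial segments, each countable, would cover \<open>\<omega>\<^sub>1\<close>.
\<close>

lemma all_lt_countable_ord_swap:
  fixes P :: "'p::countable \<Rightarrow> countable_ord \<Rightarrow> bool"
  assumes ex: "\<And>\<xi>. \<exists>p. P p \<xi>" and down: "\<And>p \<eta> \<xi>. P p \<xi> \<Longrightarrow> \<eta> \<le> \<xi> \<Longrightarrow> P p \<eta>"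
  shows "\<exists>p. \<forall>\<xi>. P p \<xi>"
proof (rule ccontr)
  assume "\<not> ?thesis"
  then obtain b where b: "\<And>p. \<not> P p (b p)" by metis
  have "\<xi> \<in> (\<Union>p. {..<b p})" for \<xi>
    using ex[of \<xi>] b down by (metis UN_iff UNIV_I lessThan_iff not_less)
  then have "countable (UNIV :: countable_ord set)"
    using countable_UN[of UNIV "\<lambda>p. {..<b p}"] countable_lessThan_countable_ord
    by (metis UNIV_eq_I countableI_type)
  then show False using uncountable_UNIV_countable_ord by blast
qed

section \<open>Strictly increasing sequences\<close>

lemma strict_mono_max:
  fixes f h :: "nat \<Rightarrow> nat"
  assumes "strict_mono f" "strict_mono h"
  shows "strict_mono (\<lambda>i. max (f i) (h i))"
proof (rule strict_monoI)
  fix i j :: nat assume "i < j"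
  then have "f i < f j" "h i < h j" using assms by (auto simp: strict_mono_less)
  then show "max (f i) (h i) < max (f j) (h j)" by linarith
qed

text \<open>
  Each \<open>M (Suc n)\<close> is a subsequence of \<open>M n\<close>. The re-indexing \<open>h\<close> is required to be strictly
  increasing on all of \<open>nat\<close>, not just from \<open>n\<close> on, so that it can be used to spread sets.
\<close>

lemma diagonal_sequence:
  fixes M :: "nat \<Rightarrow> nat \<Rightarrow> nat"
  assumes sm: "\<And>n. strict_mono (M n)"
    and sub: "\<And>n. \<exists>N. strict_mono N \<and> M (Suc n) = M n \<circ> N"
  obtains D where "strict_mono D"
    and "\<And>n. \<exists>h. strict_mono h \<and> (\<forall>i\<ge>n. D i = M n (h i))"
proof
  let ?D = "\<lambda>i. M i i"
  have le: "\<exists>j\<ge>i. M (n + k) i = M n j" for n k i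
  proof (induction k arbitrary: i)
    case (Suc k)
    obtain N where N: "strict_mono N" "M (Suc (n + k)) = M (n + k) \<circ> N" using sub by blast
    then show ?case
      using Suc[of "N i"] strict_mono_imp_increasing[OF N(1), of i] by (auto intro: order_trans)
  qed auto
  show D: "strict_mono ?D"
  proof (rule strict_mono_Suc_iff[THEN iffD2], rule allI)
    fix n
    obtain j where "j \<ge> Suc n" "M (n + 1) (Suc n) = M n j" using le by blast
    then show "?D n < ?D (Suc n)" using sm[of n] by (simp add: strict_mono_less)
  qed
  show "\<exists>h. strict_mono h \<and> (\<forall>i\<ge>n. ?D i = M n (h i))" for n
  proof -
    have "\<forall>i\<in>{n..}. \<exists>j\<ge>i. ?D i = M n j"
      using le[of _ n] by (metis atLeast_iff le_add_diff_inverse)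
    then obtain q where q: "\<And>i. i \<ge> n \<Longrightarrow> q i \<ge> i \<and> ?D i = M n (q i)"
      by (metis atLeast_iff)
    \<comment> \<open>Below \<open>n\<close> any values will do; the identity fits because \<open>i \<le> q i\<close>.\<close>
    define h where "h i = (if i < n then i else q i)" for i
    have "strict_mono h"
    proof (rule strict_mono_Suc_iff[THEN iffD2], rule allI)
      fix i
      consider "Suc i < n" | "Suc i = n" | "i \<ge> n" by linarith
      then show "h i < h (Suc i)"
      proof cases
        case 2 then show ?thesis using q[of n] by (auto simp: h_def)
      next
        case 3
        then have "M n (q i) < M n (q (Suc i))"
          using q[of i] q[of "Suc i"] strict_monoD[OF D, of i "Suc i"] by simp
        then show ?thesis using 3 sm[of n] by (simp add: h_def strict_mono_less)
      qed (auto simp: h_def)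
    qed
    then show ?thesis using q by (auto simp: h_def intro!: exI[of _ h])
  qed
qed

lemma enumerate_range_strict_mono:
  fixes m :: "nat \<Rightarrow> nat"
  assumes "strict_mono m"
  shows "enumerate (range m) = m"
proof -
  have inf: "infinite (range m)"
    using assms by (simp add: range_inj_infinite strict_mono_imp_inj_on)
  have "enumerate (range m) n = m n" for n
  proof (induction n rule: less_induct)
    case (less n)
    show ?case
    proof (cases n)
      case 0
      then show ?thesis
        using assms by (auto simp: enumerate_0 strict_mono_less_eq intro!: Least_equality)
    next
      case (Suc k)
      have "enumerate (range m) k = m k" using less Suc by simp
      then show ?thesis
        using assms inf Suc
        by (auto simp: enumerate_Suc'' strict_mono_less_eq strict_mono_less Suc_le_eq intro!: Least_equality)
    qed
  qed
  then show ?thesis by blast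
qed

section \<open>Domination of a sequence on a family of finite sets\<close>

locale dominating_basis =
  X: subsequential_space smulX R nrm + G: normed_space_over smulG
  for smulX :: "'k::real_normed_field \<Rightarrow> 'x::banach \<Rightarrow> 'x"
    and R :: "(nat \<Rightarrow> 'x) set" and nrm :: "(nat \<Rightarrow> 'x) \<Rightarrow> real"
    and smulG :: "'k \<Rightarrow> 'g::banach \<Rightarrow> 'g" +
  fixes g :: "nat \<Rightarrow> 'g" and r :: real
  assumes r_ge_1: "1 \<le> r"
    and basis: "schauder_basis smulG g"
    and normalized: "norm (g n) = 1"
    and bimono: "bimonotone smulG g"
    and right_dom: "right_dominant r smulG g"
begin

abbreviation B :: "(nat \<Rightarrow> 'x) set" where "B \<equiv> unit_ball R nrm"

definition dom_on :: "real \<Rightarrow> (nat \<Rightarrow> 'x) \<Rightarrow> (nat \<Rightarrow> 'g) \<Rightarrow> nat set \<Rightarrow> bool" where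
  "dom_on C x y F \<longleftrightarrow>
     (\<forall>a. norm (\<Sum>i\<in>F. smulX (a i) (x i)) \<le> C * norm (\<Sum>i\<in>F. smulG (a i) (y i)))"

text \<open>
  With \<open>\<F>\<close> the \<open>\<xi>\<close>-th fine Schreier family, this is the condition on the constant \<open>C\<close> in the
  definition of \<open>\<Gamma>(\<xi>, x)\<close>, with the sets \<open>M\<close> and \<open>L\<close> replaced by their increasing enumerations, so
  that passing to a subsequence is composition.
\<close>

definition dom_along :: "nat set set \<Rightarrow> real \<Rightarrow> (nat \<Rightarrow> 'x) \<Rightarrow> bool" where
  "dom_along \<F> C x \<longleftrightarrow>
     (\<exists>M L. strict_mono M \<and> strict_mono L \<and> (\<forall>F\<in>\<F>. dom_on C (x \<circ> M) (g \<circ> L) F))"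

lemma dom_on_image:
  assumes "inj_on h F" "dom_on C x y (h ` F)"
  shows "dom_on C (x \<circ> h) (y \<circ> h) F"
  unfolding dom_on_def
proof
  fix a :: "nat \<Rightarrow> 'k"
  have "\<forall>b. norm (\<Sum>i\<in>F. smulX (b (h i)) (x (h i))) \<le> C * norm (\<Sum>i\<in>F. smulG (b (h i)) (y (h i)))"
    using assms by (simp add: dom_on_def sum.reindex)
  from this[rule_format, of "a \<circ> the_inv_into F h"]
  show "norm (\<Sum>i\<in>F. smulX (a i) ((x \<circ> h) i)) \<le> C * norm (\<Sum>i\<in>F. smulG (a i) ((y \<circ> h) i))"
    using assms(1) by (simp add: the_inv_into_f_f cong: sum.cong)
qed

lemma dom_on_cong:
  assumes "\<And>i. i \<in> F \<Longrightarrow> x i = x' i" "\<And>i. i \<in> F \<Longrightarrow> y i = y' i" "dom_on C x y F"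
  shows "dom_on C x' y' F"
  using assms by (simp add: dom_on_def cong: sum.cong)

lemma dom_on_mono: "dom_on C x y F \<Longrightarrow> C \<le> C' \<Longrightarrow> dom_on C' x y F"
  unfolding dom_on_def by (meson mult_right_mono norm_ge_zero order_trans)

lemma dom_on_subset:
  assumes "dom_on C x y F" "E \<subseteq> F" "finite F"
  shows "dom_on C x y E"
  unfolding dom_on_def
proof
  fix a :: "nat \<Rightarrow> 'k"
  let ?a = "\<lambda>i. if i \<in> E then a i else 0"
  have "(\<Sum>i\<in>F. smulX (?a i) (x i)) = (\<Sum>i\<in>E. smulX (a i) (x i))"
    using assms by (intro sum.mono_neutral_cong_right) auto
  moreover have "(\<Sum>i\<in>F. smulG (?a i) (y i)) = (\<Sum>i\<in>E. smulG (a i) (y i))"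
    using assms by (intro sum.mono_neutral_cong_right) auto
  ultimately show "norm (\<Sum>i\<in>E. smulX (a i) (x i)) \<le> C * norm (\<Sum>i\<in>E. smulG (a i) (y i))"
    using assms(1)[unfolded dom_on_def, rule_format, of ?a] by simp
qed

lemma dom_on_add:
  assumes "dom_on C x z F" "dom_on D y z F"
  shows "dom_on (C + D) (\<lambda>i. x i + y i) z F"
  unfolding dom_on_def
proof
  fix a :: "nat \<Rightarrow> 'k"
  have "norm (\<Sum>i\<in>F. smulX (a i) (x i + y i))
      \<le> norm (\<Sum>i\<in>F. smulX (a i) (x i)) + norm (\<Sum>i\<in>F. smulX (a i) (y i))"
    by (simp add: X.scale_right_distrib sum.distrib norm_triangle_ineq)
  also have "\<dots> \<le> (C + D) * norm (\<Sum>i\<in>F. smulG (a i) (z i))"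
    using assms unfolding dom_on_def by (simp add: distrib_right add_mono)
  finally show "norm (\<Sum>i\<in>F. smulX (a i) (x i + y i)) \<le> (C + D) * norm (\<Sum>i\<in>F. smulG (a i) (z i))" .
qed

lemma dom_on_scale:
  assumes "dom_on C x y F"
  shows "dom_on (norm c * C) (\<lambda>i. smulX c (x i)) y F"
  unfolding dom_on_def
proof
  fix a :: "nat \<Rightarrow> 'k"
  have "(\<Sum>i\<in>F. smulX (a i) (smulX c (x i))) = smulX c (\<Sum>i\<in>F. smulX (a i) (x i))"
    by (simp add: X.scale_sum_right mult.commute)
  then show "norm (\<Sum>i\<in>F. smulX (a i) (smulX c (x i))) \<le> norm c * C * norm (\<Sum>i\<in>F. smulG (a i) (y i))"
    using assms by (simp add: X.norm_scale dom_on_def mult.assoc mult_left_mono)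
qed

text \<open>
  Replacing \<open>l\<close> by the maximum of \<open>m\<close> and \<open>l\<close> does not change the sum on the right and makes the
  comparison of \<open>m\<close> with \<open>l\<close> hold everywhere.
\<close>

lemma right_dominant_on:
  fixes m l :: "nat \<Rightarrow> nat"
  assumes "strict_mono m" "strict_mono l" "\<And>i. i \<in> F \<Longrightarrow> m i \<le> l i"
  shows "norm (\<Sum>i\<in>F. smulG (a i) (g (m i))) \<le> r * norm (\<Sum>i\<in>F. smulG (a i) (g (l i)))"
proof (cases "finite F")
  case True
  define b where "b i = (if i \<in> F then a i else 0)" for i
  define l' where "l' i = max (m i) (l i)" for i
  have "strict_mono l'"
    using assms(1,2) unfolding l'_def by (rule strict_mono_max)
  moreover have fin: "finite {i. b i \<noteq> 0}"
    using True by (rule rev_finite_subset) (auto simp: b_def split: if_splits)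
  ultimately have "norm (\<Sum>i | b i \<noteq> 0. smulG (b i) (g (m i))) \<le> r * norm (\<Sum>i | b i \<noteq> 0. smulG (b i) (g (l' i)))"
    using right_dom[unfolded right_dominant_def, rule_format, of m l' b] assms(1) by (simp add: l'_def)
  moreover have "(\<Sum>i | b i \<noteq> 0. smulG (b i) (g (m i))) = (\<Sum>i\<in>F. smulG (a i) (g (m i)))"
    using True by (intro sum.mono_neutral_cong_left) (auto simp: b_def split: if_splits)
  moreover have "(\<Sum>i | b i \<noteq> 0. smulG (b i) (g (l' i))) = (\<Sum>i\<in>F. smulG (a i) (g (l i)))"
    using True assms(3)
    by (intro sum.mono_neutral_cong_left) (auto simp: b_def l'_def max_absorb2 split: if_splits)
  ultimately show ?thesis by simp
qed simp

lemma dom_on_right: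
  assumes "dom_on C x (g \<circ> m) F" "0 \<le> C" "strict_mono m" "strict_mono l" "\<And>i. i \<in> F \<Longrightarrow> m i \<le> l i"
  shows "dom_on (r * C) x (g \<circ> l) F"
  unfolding dom_on_def
proof
  fix a :: "nat \<Rightarrow> 'k"
  have "norm (\<Sum>i\<in>F. smulX (a i) (x i)) \<le> C * norm (\<Sum>i\<in>F. smulG (a i) (g (m i)))"
    using assms(1) by (simp add: dom_on_def)
  also have "\<dots> \<le> C * (r * norm (\<Sum>i\<in>F. smulG (a i) (g (l i))))"
    using assms by (intro mult_left_mono right_dominant_on) auto
  finally show "norm (\<Sum>i\<in>F. smulX (a i) (x i)) \<le> r * C * norm (\<Sum>i\<in>F. smulG (a i) ((g \<circ> l) i))"
    by (simp add: ac_simps)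
qed

text \<open>
  For a finitely supported vector the basis coefficients are the given ones by uniqueness of the
  expansion, so the basis projection onto \<open>I\<close> is the partial sum over \<open>I\<close>.
\<close>

lemma norm_interval_part_le:
  assumes F: "finite F" and I: "nat_interval I"
  shows "norm (\<Sum>i\<in>F \<inter> I. smulG (b i) (g i)) \<le> norm (\<Sum>i\<in>F. smulG (b i) (g i))"
proof -
  define x where "x = (\<Sum>i\<in>F. smulG (b i) (g i))"
  define b' where "b' i = (if i \<in> F then b i else 0)" for i
  have "(\<lambda>n. smulG (b' n) (g n)) sums (\<Sum>i\<in>F. smulG (b' i) (g i))"
    by (rule sums_finite[OF F]) (simp add: b'_def)
  then have sums: "(\<lambda>n. smulG (b' n) (g n)) sums x"
    by (simp add: x_def b'_def cong: sum.cong)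
  then have coeff: "basis_coeff smulG g x = b'"
    using basis unfolding schauder_basis_def basis_coeff_def by (metis (mono_tags, lifting) the1_equality)
  have "(\<lambda>n. if n \<in> I then smulG (b' n) (g n) else 0) sums
      (\<Sum>n\<in>F. if n \<in> I then smulG (b' n) (g n) else 0)"
    by (rule sums_finite[OF F]) (simp add: b'_def)
  then have "basis_proj smulG g I x = (\<Sum>n\<in>F. if n \<in> I then smulG (b' n) (g n) else 0)"
    unfolding basis_proj_def coeff by (rule sums_unique[symmetric])
  also have "\<dots> = (\<Sum>i\<in>F \<inter> I. smulG (b i) (g i))"
    using F by (simp add: sum.inter_restrict b'_def cong: sum.cong if_cong)
  finally show ?thesis
    using bimono I unfolding bimonotone_def x_def by metis
qed

text \<open>
  The first term and the remaining sum are both parts of the basis expansion over an interval, so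
  bimonotonicity bounds both by the norm of the whole; one extra term costs at most \<open>1\<close>.
\<close>

lemma dom_on_insert:
  assumes dom: "dom_on C x (g \<circ> l) F" and l: "strict_mono l" and F: "finite F" "\<And>k. k \<in> F \<Longrightarrow> n < k"
    and x: "norm (x n) \<le> 1" and C: "0 \<le> C"
  shows "dom_on (C + 1) x (g \<circ> l) (insert n F)"
  unfolding dom_on_def
proof
  fix a :: "nat \<Rightarrow> 'k"
  have n: "n \<notin> F" using F(2) by blast
  have inj: "inj_on l A" for A using l by (meson inj_on_subset strict_mono_imp_inj_on subset_UNIV)
  define b where "b = a \<circ> the_inv_into UNIV l"
  have b: "b (l i) = a i" for i using inj by (simp add: b_def the_inv_into_f_f)
  let ?N = "norm (\<Sum>i\<in>insert n F. smulG (a i) ((g \<circ> l) i))"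
  have part: "norm (\<Sum>i\<in>A. smulG (a i) (g (l i))) \<le> ?N"
    if "A \<subseteq> insert n F" "nat_interval I" "l ` insert n F \<inter> I = l ` A" for A I
    using norm_interval_part_le[of "l ` insert n F" I b] that F
    by (simp only: sum.reindex[OF inj] o_def b finite_imageI finite.insertI)
  have "norm (a n) \<le> ?N"
    using part[of "{n}" "{l n}"] n inj[of UNIV]
    by (auto simp: nat_interval_def G.norm_scale normalized inj_eq)
  moreover have "norm (\<Sum>i\<in>F. smulG (a i) (g (l i))) \<le> ?N"
    using F l by (intro part[of F "{l n<..}"]) (auto simp: nat_interval_def strict_mono_less)
  ultimately have "norm (smulX (a n) (x n)) + norm (\<Sum>i\<in>F. smulX (a i) (x i)) \<le> ?N + C * ?N"
    using dom x C
    by (intro add_mono order_trans[OF dom[unfolded dom_on_def, rule_format]] mult_left_mono)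
       (auto simp: X.norm_scale intro: order_trans[OF mult_left_le])
  then show "norm (\<Sum>i\<in>insert n F. smulX (a i) (x i)) \<le> (C + 1) * ?N"
    using F(1) n by (simp add: algebra_simps) (meson norm_triangle_ineq order_trans)
qed

lemma dom_along_mono: "dom_along \<F> C x \<Longrightarrow> C \<le> C' \<Longrightarrow> dom_along \<F> C' x"
  unfolding dom_along_def using dom_on_mono by blast

lemma dom_along_scale:
  "dom_along \<F> C x \<Longrightarrow> dom_along \<F> (norm c * C) (\<lambda>n. smulX c (x n))"
  unfolding dom_along_def comp_def by (blast dest: dom_on_scale)

text \<open>
  Passing to a subsequence of \<open>x\<close> makes domination harder: it only restricts the choice of \<open>M\<close>.
\<close>

lemma dom_along_subseq:
  assumes "strict_mono k" "dom_along \<F> C (x \<circ> k)"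
  shows "dom_along \<F> C x"
proof -
  obtain M L where "strict_mono M" "strict_mono L" "\<forall>F\<in>\<F>. dom_on C (x \<circ> k \<circ> M) (g \<circ> L) F"
    using assms(2) unfolding dom_along_def by blast
  then show ?thesis
    using strict_mono_o[OF assms(1), of M] unfolding dom_along_def comp_assoc by blast
qed

lemma dom_on_spread:
  assumes "strict_mono h" "spreading \<F>" "\<forall>F\<in>\<F>. dom_on C x y F" "F \<in> \<F>"
  shows "dom_on C (x \<circ> h) (y \<circ> h) F"
proof (rule dom_on_image)
  show "inj_on h F" using strict_mono_imp_inj_on[OF assms(1)] inj_on_subset by blast
  show "dom_on C x y (h ` F)" using assms unfolding spreading_def by blast
qed

text \<open>
  Deleting finitely many terms does not make domination harder: as the family is spreading, the
  first \<open>k\<close> chosen indices may be dropped from \<open>M\<close> and \<open>L\<close>, and the others are beyond the deleted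
  terms.
\<close>

lemma dom_along_shift:
  assumes \<F>: "spreading \<F>" and x: "dom_along \<F> C x"
  shows "dom_along \<F> C (\<lambda>i. x (i + k))"
proof -
  obtain M L where w: "strict_mono M" "strict_mono L" "\<forall>F\<in>\<F>. dom_on C (x \<circ> M) (g \<circ> L) F"
    using x unfolding dom_along_def by blast
  define h where "h i = i + k" for i :: nat
  have h: "strict_mono h" by (simp add: h_def strict_mono_def)
  have ge: "k \<le> M (i + k)" for i
    using strict_mono_imp_increasing[OF w(1), of "i + k"] by simp
  have "strict_mono (\<lambda>i. M (i + k) - k)"
  proof (rule strict_monoI)
    fix i j :: nat assume "i < j"
    then have "M (i + k) < M (j + k)" using w(1) by (simp add: strict_mono_less)
    then show "M (i + k) - k < M (j + k) - k" using ge[of i] by linarith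
  qed
  moreover have "(\<lambda>i. x (i + k)) \<circ> (\<lambda>i. M (i + k) - k) = x \<circ> M \<circ> h"
    using ge by (auto simp: h_def)
  ultimately show ?thesis
    using dom_on_spread[OF h \<F> w(3)] strict_mono_o[OF w(2) h]
    unfolding dom_along_def by (intro exI[of _ "\<lambda>i. M (i + k) - k"] exI[of _ "L \<circ> h"]) (simp add: comp_assoc)
qed

text \<open>
  Only the sets of a family that lie far out matter, for the same reason.
\<close>

lemma dom_along_tail:
  assumes \<H>: "spreading \<H>" and sub: "\<And>F. F \<in> \<H> \<Longrightarrow> \<forall>i\<in>F. n \<le> i \<Longrightarrow> F \<in> \<G>"
    and x: "dom_along \<G> C x"
  shows "dom_along \<H> C x"
proof -
  obtain M L where w: "strict_mono M" "strict_mono L" "\<forall>F\<in>\<G>. dom_on C (x \<circ> M) (g \<circ> L) F"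
    using x unfolding dom_along_def by blast
  define h where "h i = i + n" for i :: nat
  have h: "strict_mono h" by (simp add: h_def strict_mono_def)
  have "dom_on C (x \<circ> M \<circ> h) (g \<circ> L \<circ> h) F" if "F \<in> \<H>" for F
  proof (rule dom_on_image)
    show "inj_on h F" by (simp add: h_def inj_on_def)
    have "h ` F \<in> \<G>" using that \<H> h by (intro sub) (auto simp: spreading_def, simp add: h_def)
    then show "dom_on C (x \<circ> M) (g \<circ> L) (h ` F)" using w(3) by blast
  qed
  then show ?thesis
    using strict_mono_o[OF w(1) h] strict_mono_o[OF w(2) h]
    unfolding dom_along_def comp_assoc by blast
qed

text \<open>
  A single pair \<open>(M, L)\<close> has to serve both summands. The domination of \<open>y\<close> is therefore assumed along
  every subsequence, so that it can be refined inside the \<open>M\<close> that is good for \<open>x\<close>. The two index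
  sequences in the basis are merged by taking their maximum, which costs the factor \<open>r\<close>.
\<close>

lemma dom_along_add:
  assumes \<F>: "spreading \<F>" and x: "dom_along \<F> C x" "0 \<le> C"
    and y: "\<And>k. strict_mono k \<Longrightarrow> dom_along \<F> D (y \<circ> k)" "0 \<le> D"
  shows "dom_along \<F> (r * (C + D)) (\<lambda>i. x i + y i)"
proof -
  obtain M L where w: "strict_mono M" "strict_mono L" "\<forall>F\<in>\<F>. dom_on C (x \<circ> M) (g \<circ> L) F"
    using x unfolding dom_along_def by blast
  obtain N K where v: "strict_mono N" "strict_mono K" "\<forall>F\<in>\<F>. dom_on D (y \<circ> M \<circ> N) (g \<circ> K) F"
    using y(1)[OF w(1)] unfolding dom_along_def by blast
  define J where "J i = max (L (N i)) (K i)" for i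
  have LN: "strict_mono (L \<circ> N)" by (rule strict_mono_o[OF w(2) v(1)])
  have J: "strict_mono J"
    using strict_mono_max[OF LN v(2)] by (simp add: J_def[abs_def])
  have "dom_on (r * (C + D)) ((\<lambda>i. x i + y i) \<circ> (M \<circ> N)) (g \<circ> J) F" if F: "F \<in> \<F>" for F
  proof -
    have "dom_on (r * C) (x \<circ> M \<circ> N) (g \<circ> J) F"
      using dom_on_spread[OF v(1) \<F> w(3) F] LN J x(2)
      by (intro dom_on_right[where m = "L \<circ> N"]) (auto simp: J_def comp_assoc)
    moreover have "dom_on (r * D) (y \<circ> M \<circ> N) (g \<circ> J) F"
      using v J y(2) F by (intro dom_on_right[where m = K]) (auto simp: J_def)
    ultimately show ?thesis
      using dom_on_add by (fastforce simp: comp_def distrib_left)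
  qed
  then show ?thesis
    using strict_mono_o[OF w(1) v(1)] J unfolding dom_along_def by blast
qed

section \<open>Subsequential spaces\<close>

lemma nrm_minus: "x \<in> R \<Longrightarrow> (\<lambda>n. - x n) \<in> R \<and> nrm (\<lambda>n. - x n) = nrm x"
  using X.scale_mem[of x "-1"] X.nrm_scale[of x "-1"] by (simp add: X.scale_minus_left)

lemma diff_mem: "x \<in> R \<Longrightarrow> y \<in> R \<Longrightarrow> (\<lambda>n. x n - y n) \<in> R"
  using X.add_mem[of x "\<lambda>n. - y n"] nrm_minus by simp

lemma nrm_diff_commute: "x \<in> R \<Longrightarrow> y \<in> R \<Longrightarrow> nrm (\<lambda>n. x n - y n) = nrm (\<lambda>n. y n - x n)"
  using nrm_minus[OF diff_mem, of x y] by simp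

lemma nrm_diff_triangle:
  "x \<in> R \<Longrightarrow> y \<in> R \<Longrightarrow> z \<in> R \<Longrightarrow> nrm (\<lambda>n. x n - z n) \<le> nrm (\<lambda>n. x n - y n) + nrm (\<lambda>n. y n - z n)"
  using X.nrm_triangle[OF diff_mem diff_mem, of x y y z] by simp

lemma subseq_mem_R:
  assumes x: "x \<in> R" and k: "strict_mono k"
  shows "x \<circ> k \<in> R"
proof -
  define t where "t = max 1 (nrm x)"
  have t: "0 < t" "nrm x \<le> t" by (simp_all add: t_def)
  let ?y = "\<lambda>n. smulX (of_real (inverse t)) (x n)"
  have "?y \<in> B"
    using x X.scale_mem X.nrm_scale[OF x, of "of_real (inverse t)"] t
    by (simp only: unit_ball_def norm_of_real) (simp add: divide_le_eq flip: divide_inverse_commute)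
  then have "?y \<circ> k \<in> R"
    using X.subseq_mem_ball[OF _ k] by (auto simp: unit_ball_def)
  from X.scale_mem[OF this, of "of_real t"] show ?thesis
    using t by (simp add: comp_def X.scale_of_real del: of_real_inverse)
qed

text \<open>
  The uniform bound \<open>K\<close> on the unit ball applies to \<open>K x\<close>.
\<close>

lemma dom_along_small:
  assumes bound: "\<And>y. y \<in> B \<Longrightarrow> dom_along \<F> K y" and K: "0 < K"
    and x: "x \<in> R" "K * nrm x \<le> 1" and k: "strict_mono k"
  shows "dom_along \<F> 1 (x \<circ> k)"
proof -
  let ?y = "\<lambda>n. smulX (of_real K) (x n)"
  have "?y \<in> B"
    using x X.scale_mem X.nrm_scale K by (auto simp: unit_ball_def)
  then have "dom_along \<F> K (?y \<circ> k)"
    using X.subseq_mem_ball[OF _ k] bound by blast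
  from dom_along_scale[OF this, of "of_real (inverse K)"] show ?thesis
    using K by (simp add: comp_def X.scale_of_real del: of_real_inverse)
qed

text \<open>
  Otherwise successive refinements \<open>x \<circ> M n\<close> would need constants larger than \<open>n\<close>. Their diagonal
  sequence is, up to finitely many terms, a subsequence of each of them, hence needs a constant
  larger than every \<open>n\<close>, although it is a member of \<open>R\<close>.
\<close>

lemma hereditary_bound:
  assumes \<G>: "spreading \<G>" and pointwise: "\<And>x. x \<in> R \<Longrightarrow> \<exists>C. dom_along \<G> C x" and x: "x \<in> R"
  shows "\<exists>(M :: nat \<Rightarrow> nat) H. strict_mono M \<and> 0 \<le> H \<and> (\<forall>k. strict_mono k \<longrightarrow> dom_along \<G> H (x \<circ> M \<circ> k))"
proof (rule ccontr)
  assume no_bound: "\<not> ?thesis"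
  have bad: "\<exists>k. strict_mono k \<and> \<not> dom_along \<G> (real n) (x \<circ> M \<circ> k)"
    if "strict_mono M" for n and M :: "nat \<Rightarrow> nat"
    using no_bound that of_nat_0_le_iff[of n, where ?'a = real] by blast
  have "\<exists>M :: nat \<Rightarrow> nat \<Rightarrow> nat. \<forall>n. (strict_mono (M n) \<and> \<not> dom_along \<G> (real n) (x \<circ> M n)) \<and>
      (\<exists>N. strict_mono N \<and> M (Suc n) = M n \<circ> N)"
  proof (rule dependent_nat_choice)
    show "\<exists>M. strict_mono M \<and> \<not> dom_along \<G> (real 0) (x \<circ> M)"
      using bad[OF strict_mono_id, of 0] by (auto simp: comp_assoc)
  next
    fix M :: "nat \<Rightarrow> nat" and n assume "strict_mono M \<and> \<not> dom_along \<G> (real n) (x \<circ> M)"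
    then show "\<exists>M'. (strict_mono M' \<and> \<not> dom_along \<G> (real (Suc n)) (x \<circ> M')) \<and>
        (\<exists>N. strict_mono N \<and> M' = M \<circ> N)"
      using bad[of M "Suc n"] strict_mono_o[of M] unfolding comp_assoc by blast
  qed
  then obtain M where M: "\<And>n. strict_mono (M n) \<and> \<not> dom_along \<G> (real n) (x \<circ> M n)"
    and sub: "\<And>n. \<exists>N. strict_mono N \<and> M (Suc n) = M n \<circ> N" by blast
  obtain D where D: "strict_mono D" and h: "\<And>n. \<exists>h. strict_mono h \<and> (\<forall>i\<ge>n. D i = M n (h i))"
    using diagonal_sequence[of M] M sub by blast
  obtain C where C: "dom_along \<G> C (x \<circ> D)"
    using pointwise[OF subseq_mem_R[OF x D]] by blast
  obtain n where n: "C \<le> real n" using real_arch_simple by blast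
  obtain h where h: "strict_mono h" "\<forall>i\<ge>n. D i = M n (h i)" using h by blast
  have "dom_along \<G> (real n) (\<lambda>i. (x \<circ> D) (i + n))"
    using dom_along_shift[OF \<G> C] dom_along_mono n by blast
  moreover have "(\<lambda>i. (x \<circ> D) (i + n)) = (x \<circ> M n) \<circ> (\<lambda>i. h (i + n))"
    using h(2) by auto
  moreover have "strict_mono (\<lambda>i. h (i + n))" using h(1) by (simp add: strict_mono_def)
  ultimately show False using dom_along_subseq M by metis
qed

text \<open>
  The coefficients halve at each step, so the remainder after \<open>n\<close> terms is at most twice the first
  omitted coefficient.
\<close>

lemma geometric_series_converges:
  assumes \<sigma>: "\<And>n. \<sigma> n \<in> R" and \<rho>: "\<And>n. \<rho> n \<in> B"
    and step: "\<And>n. \<sigma> (Suc n) = (\<lambda>i. \<sigma> n i + c n *\<^sub>R \<rho> n i)"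
    and c: "\<And>n. 0 < c n" "\<And>n. c (Suc n) \<le> c n / 2"
  obtains \<tau> where "\<tau> \<in> R" "\<And>n. nrm (\<lambda>i. \<tau> i - \<sigma> n i) \<le> 2 * c n"
proof -
  have inc: "nrm (\<lambda>i. \<sigma> (Suc n) i - \<sigma> n i) \<le> c n" for n
    using \<rho>[of n] X.nrm_scale[of "\<rho> n" "of_real (c n)"] c(1)[of n]
    by (simp add: step unit_ball_def X.scale_of_real mult_left_le)
  have bd: "nrm (\<lambda>i. \<sigma> (n + k) i - \<sigma> n i) \<le> 2 * c n - 2 * c (n + k)" for n k
  proof (induction k)
    case 0
    have "(\<lambda>n. 0) \<in> R" by (rule X.c00_subset) simp
    then show ?case using X.nrm_eq_0[of "\<lambda>n. 0"] by simp
  next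
    case (Suc k)
    have "nrm (\<lambda>i. \<sigma> (n + Suc k) i - \<sigma> n i)
        \<le> nrm (\<lambda>i. \<sigma> (Suc (n + k)) i - \<sigma> (n + k) i) + nrm (\<lambda>i. \<sigma> (n + k) i - \<sigma> n i)"
      using nrm_diff_triangle[OF \<sigma>[of "Suc (n + k)"] \<sigma>[of "n + k"] \<sigma>[of n]] by simp
    then show ?case using Suc inc[of "n + k"] c(2)[of "n + k"] by simp
  qed
  have bd': "nrm (\<lambda>i. \<sigma> m i - \<sigma> n i) \<le> 2 * c n" if "n \<le> m" for m n
    using bd[of n "m - n"] c(1)[of m] that by simp
  have c_le: "c n \<le> c 0 * (1/2) ^ n" for n
    by (induction n) (use c(2) in \<open>auto intro: order_trans\<close>)
  have "\<exists>\<tau>\<in>R. (\<lambda>i. nrm (\<lambda>n. \<sigma> i n - \<tau> n)) \<longlonglongrightarrow> 0"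
  proof (rule X.nrm_complete[OF \<sigma>])
    fix e :: real assume e: "0 < e"
    have "(\<lambda>n. 4 * (c 0 * (1/2) ^ n)) \<longlonglongrightarrow> 0"
      by (auto intro!: tendsto_eq_intros LIMSEQ_power_zero)
    then obtain N where N: "4 * (c 0 * (1/2) ^ N) < e"
      using e by (metis (no_types, lifting) eventually_happens order_tendstoD(2) sequentially_bot)
    have "nrm (\<lambda>n. \<sigma> i n - \<sigma> j n) < e" if "i \<ge> N" "j \<ge> N" for i j
      using nrm_diff_triangle[OF \<sigma>[of i] \<sigma>[of N] \<sigma>[of j]] nrm_diff_commute[OF \<sigma>[of N] \<sigma>[of j]]
        bd'[OF that(1)] bd'[OF that(2)] c_le[of N] N by linarith
    then show "\<exists>N. \<forall>i\<ge>N. \<forall>j\<ge>N. nrm (\<lambda>n. \<sigma> i n - \<sigma> j n) < e" by blast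
  qed
  then obtain \<tau> where \<tau>: "\<tau> \<in> R" "(\<lambda>i. nrm (\<lambda>n. \<sigma> i n - \<tau> n)) \<longlonglongrightarrow> 0" by blast
  have "nrm (\<lambda>i. \<tau> i - \<sigma> n i) \<le> 2 * c n" for n
  proof (rule LIMSEQ_le_const)
    show "(\<lambda>m. nrm (\<lambda>i. \<sigma> m i - \<tau> i) + 2 * c n) \<longlonglongrightarrow> 2 * c n"
      using tendsto_add[OF \<tau>(2) tendsto_const] by simp
    show "\<exists>N. \<forall>m\<ge>N. nrm (\<lambda>i. \<tau> i - \<sigma> n i) \<le> nrm (\<lambda>i. \<sigma> m i - \<tau> i) + 2 * c n"
      using nrm_diff_triangle[OF \<tau>(1) \<sigma> \<sigma>] nrm_diff_commute[OF \<sigma> \<tau>(1)] bd'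
      by (intro exI[of _ n]) (metis add_left_mono order_trans)
  qed
  then show thesis using that \<tau>(1) by blast
qed

section \<open>Uniform boundedness\<close>

text \<open>
  A gliding hump. If no constant works for \<open>\<G>\<close> on the unit ball, then by \<open>approx\<close> there are members
  \<open>\<rho>\<close> of the ball that are arbitrarily bad for some \<open>\<H> \<in> \<S>\<close>, and this \<open>\<H>\<close> has a uniform bound \<open>K\<close>.
  Sum a sequence of such \<open>\<rho> n\<close> with coefficients \<open>c n\<close>. Look at the sum \<open>\<tau>\<close> through the family \<open>\<H> n\<close>:

    \<^item> the terms before the \<open>n\<close>-th are dominated with a constant \<open>H\<close> known before \<open>\<rho> n\<close> is chosen, and
      this holds along all further subsequences by \<open>hereditary_bound\<close>;
    \<^item> the terms after the \<open>n\<close>-th have norm at most \<open>1 / K n\<close>, as their coefficients are chosen after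
      \<open>K n\<close>, so they are dominated with constant \<open>1\<close>;
    \<^item> \<open>\<tau>\<close> itself is dominated with some constant \<open>C\<close>, by assumption.

  If \<open>n \<ge> C\<close>, this bounds the constant of \<open>\<rho> n\<close> by a quantity that the choice of \<open>\<rho> n\<close> has exceeded.
  A uniform bound for the tails is what makes the argument work: along
  \<open>\<G>\<close> a small norm gives no control of the constant at this stage, but along \<open>\<H> n\<close> it does.
\<close>

lemma uniform_boundedness:
  assumes \<G>: "spreading \<G>"
    and spread: "\<And>\<H>. \<H> \<in> \<S> \<Longrightarrow> spreading \<H>"
    and tail: "\<And>\<H>. \<H> \<in> \<S> \<Longrightarrow> \<exists>n. \<forall>F\<in>\<H>. (\<forall>i\<in>F. n \<le> i) \<longrightarrow> F \<in> \<G>"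
    and unif: "\<And>\<H>. \<H> \<in> \<S> \<Longrightarrow> \<exists>K. \<forall>x\<in>B. dom_along \<H> K x"
    and approx: "\<And>x C. 0 < C \<Longrightarrow> (\<And>\<H> k. \<H> \<in> \<S> \<Longrightarrow> strict_mono k \<Longrightarrow> dom_along \<H> C (x \<circ> k)) \<Longrightarrow>
      dom_along \<G> (r * C) x"
    and pointwise: "\<And>x. x \<in> R \<Longrightarrow> \<exists>C. dom_along \<G> C x"
  shows "\<exists>K. \<forall>x\<in>B. dom_along \<G> K x"
proof (rule ccontr)
  assume unbounded: "\<not> ?thesis"
  have r0: "0 < r" using r_ge_1 by simp
  have bad: "\<exists>\<rho>\<in>B. \<exists>\<H>\<in>\<S>. \<exists>K\<ge>1. (\<forall>x\<in>B. dom_along \<H> K x) \<and> \<not> dom_along \<H> D \<rho>" for D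
  proof -
    define D' where "D' = max 1 D"
    obtain x where x: "x \<in> B" "\<not> dom_along \<G> (r * D') x" using unbounded by blast
    obtain \<H> k where \<H>: "\<H> \<in> \<S>" and k: "strict_mono k" "\<not> dom_along \<H> D' (x \<circ> k)"
      using approx[of D' x] x(2) by (force simp: D'_def)
    obtain K where "\<forall>x\<in>B. dom_along \<H> K x" using unif[OF \<H>] by blast
    then have "\<forall>x\<in>B. dom_along \<H> (max 1 K) x" using dom_along_mono by fastforce
    moreover have "\<not> dom_along \<H> D (x \<circ> k)"
      using k(2) dom_along_mono[of \<H> D "x \<circ> k" D'] by (auto simp: D'_def)
    moreover have "x \<circ> k \<in> B" using X.subseq_mem_ball x(1) k(1) by blast
    ultimately show ?thesis using \<H> by (meson max.cobounded1)
  qed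
  \<comment> \<open>A state holds the partial sum, the index sequence refined so far, and the data of the next
    term. The threshold that \<open>\<rho>\<close> exceeds is what two applications of \<open>dom_along_add\<close> give for
    \<open>\<rho> = (\<tau> - \<sigma> - rest) / c\<close>, with \<open>n\<close> in place of the unknown constant of \<open>\<tau>\<close>.\<close>
  define P where "P n s = (case s of (\<sigma>, M, c, \<rho>, \<H>, K) \<Rightarrow>
      \<sigma> \<in> R \<and> strict_mono M \<and> 0 < c \<and> \<rho> \<in> B \<and> \<H> \<in> \<S> \<and> 1 \<le> K \<and> (\<forall>x\<in>B. dom_along \<H> K x) \<and>
      (\<exists>H\<ge>0. (\<forall>k. strict_mono k \<longrightarrow> dom_along \<G> H (\<sigma> \<circ> M \<circ> k)) \<and>
        \<not> dom_along \<H> (r * (r * (real n + H) + 1) / c) \<rho>))"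
    for n :: nat and s :: "(nat \<Rightarrow> 'x) \<times> (nat \<Rightarrow> nat) \<times> real \<times> (nat \<Rightarrow> 'x) \<times> nat set set \<times> real"
  define Q where "Q s s' = (case s of (\<sigma>, M, c, \<rho>, \<H>, K) \<Rightarrow> case s' of (\<sigma>', M', c', \<rho>', \<H>', K') \<Rightarrow>
      \<sigma>' = (\<lambda>i. \<sigma> i + c *\<^sub>R \<rho> i) \<and> (\<exists>N. strict_mono N \<and> M' = M \<circ> N) \<and>
      c' \<le> c / 2 \<and> c' \<le> 1 / (2 * K))"
    for s s' :: "(nat \<Rightarrow> 'x) \<times> (nat \<Rightarrow> nat) \<times> real \<times> (nat \<Rightarrow> 'x) \<times> nat set set \<times> real"
  have extend: "\<exists>M' \<rho> \<H> K. P n (\<sigma>, M', c, \<rho>, \<H>, K) \<and> (\<exists>N. strict_mono N \<and> M' = M \<circ> N)"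
    if st: "\<sigma> \<in> R" "strict_mono M" "0 < c" for \<sigma> c n and M :: "nat \<Rightarrow> nat"
  proof -
    have "\<exists>(N :: nat \<Rightarrow> nat) H. strict_mono N \<and> 0 \<le> H \<and>
        (\<forall>k. strict_mono k \<longrightarrow> dom_along \<G> H (\<sigma> \<circ> M \<circ> N \<circ> k))"
      by (rule hereditary_bound[OF \<G> _ subseq_mem_R[OF st(1,2)]]) (rule pointwise)
    then obtain N :: "nat \<Rightarrow> nat" and H where N: "strict_mono N" "0 \<le> H"
      "\<And>k. strict_mono k \<Longrightarrow> dom_along \<G> H (\<sigma> \<circ> M \<circ> N \<circ> k)"
      by blast
    obtain \<rho> \<H> K where "\<rho> \<in> B" "\<H> \<in> \<S>" "1 \<le> K" "\<forall>x\<in>B. dom_along \<H> K x"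
      "\<not> dom_along \<H> (r * (r * (real n + H) + 1) / c) \<rho>"
      using bad by meson
    then have "P n (\<sigma>, M \<circ> N, c, \<rho>, \<H>, K)"
      using st N strict_mono_o[OF st(2) N(1)] unfolding P_def by (auto simp: comp_assoc)
    then show ?thesis using N(1) by blast
  qed
  have "\<exists>s. \<forall>n. P n (s n) \<and> Q (s n) (s (Suc n))"
  proof (rule dependent_nat_choice)
    have "(\<lambda>i. 0) \<in> R" by (rule X.c00_subset) simp
    then show "\<exists>s. P 0 s" using extend[OF _ strict_mono_id zero_less_one] by blast
  next
    fix s n assume "P n s"
    moreover obtain \<sigma> M c \<rho> \<H> K where s: "s = (\<sigma>, M, c, \<rho>, \<H>, K)" by (cases s)
    ultimately have *: "\<sigma> \<in> R" "strict_mono M" "0 < c" "\<rho> \<in> R" "1 \<le> K"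
      by (auto simp: P_def unit_ball_def)
    define c' where "c' = min (c / 2) (1 / (2 * K))"
    have c': "0 < c'" using * by (simp add: c'_def)
    have "(\<lambda>i. \<sigma> i + c *\<^sub>R \<rho> i) \<in> R"
      using X.add_mem[OF *(1) X.scale_mem[OF *(4), of "of_real c"]] by (simp add: X.scale_of_real)
    from extend[OF this *(2) c', of "Suc n"] show "\<exists>s'. P (Suc n) s' \<and> Q s s'"
      unfolding s Q_def by (force simp: c'_def)
  qed
  then obtain s where s: "\<And>n. P n (s n)" "\<And>n. Q (s n) (s (Suc n))" by blast
  define \<sigma> M c \<rho> \<H> K where "\<sigma> n = fst (s n)" and "M n = fst (snd (s n))" and "c n = fst (snd (snd (s n)))"
    and "\<rho> n = fst (snd (snd (snd (s n))))" and "\<H> n = fst (snd (snd (snd (snd (s n)))))"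
    and "K n = snd (snd (snd (snd (snd (s n)))))" for n
  note proj = \<sigma>_def M_def c_def \<rho>_def \<H>_def K_def
  have \<sigma>: "\<sigma> n \<in> R" and M: "strict_mono (M n)" and c: "0 < c n" and \<rho>: "\<rho> n \<in> B" and \<H>: "\<H> n \<in> \<S>"
    and K: "1 \<le> K n" and bound: "\<forall>x\<in>B. dom_along (\<H> n) (K n) x"
    and gap: "\<exists>H\<ge>0. (\<forall>k. strict_mono k \<longrightarrow> dom_along \<G> H (\<sigma> n \<circ> M n \<circ> k)) \<and>
        \<not> dom_along (\<H> n) (r * (r * (real n + H) + 1) / c n) (\<rho> n)" for n
    using s(1)[of n] by (auto simp: P_def proj split: prod.splits)
  have \<sigma>_Suc: "\<sigma> (Suc n) = (\<lambda>i. \<sigma> n i + c n *\<^sub>R \<rho> n i)" and M_Suc: "\<exists>N. strict_mono N \<and> M (Suc n) = M n \<circ> N"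
    and c_half: "c (Suc n) \<le> c n / 2" and c_K: "c (Suc n) \<le> 1 / (2 * K n)" for n
    using s(2)[of n] by (auto simp: Q_def proj split: prod.splits)
  obtain \<tau> where \<tau>: "\<tau> \<in> R" "\<And>n. nrm (\<lambda>i. \<tau> i - \<sigma> n i) \<le> 2 * c n"
    using geometric_series_converges[of \<sigma> \<rho> c] \<sigma> \<rho> \<sigma>_Suc c c_half by blast
  obtain D where D: "strict_mono D" and h: "\<And>n. \<exists>h. strict_mono h \<and> (\<forall>i\<ge>n. D i = M n (h i))"
    using diagonal_sequence[of M] M M_Suc by blast
  obtain C where "dom_along \<G> C (\<tau> \<circ> D)"
    using pointwise[OF subseq_mem_R[OF \<tau>(1) D]] by blast
  moreover obtain n where "C \<le> real n" using real_arch_simple by blast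
  ultimately have n: "dom_along \<G> (real n) (\<tau> \<circ> D)" using dom_along_mono by blast
  obtain h where h: "strict_mono h" "\<And>i. i \<ge> n \<Longrightarrow> D i = M n (h i)" using h by blast
  obtain H where H: "0 \<le> H" "\<And>k. strict_mono k \<Longrightarrow> dom_along \<G> H (\<sigma> n \<circ> M n \<circ> k)"
    "\<not> dom_along (\<H> n) (r * (r * (real n + H) + 1) / c n) (\<rho> n)"
    using gap by blast
  define q where "q = M n \<circ> (\<lambda>i. h (i + n))"
  have shift: "strict_mono (\<lambda>i. h (i + n))" using h(1) by (simp add: strict_mono_def)
  have q: "strict_mono q" unfolding q_def by (rule strict_mono_o[OF M shift])
  have "(\<lambda>i. (\<tau> \<circ> D) (i + n)) = \<tau> \<circ> q" using h(2) by (auto simp: q_def)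
  then have sum: "dom_along \<G> (real n) (\<tau> \<circ> q)" using dom_along_shift[OF \<G> n, of n] by simp
  have head: "dom_along \<G> H ((\<lambda>i. - (\<sigma> n \<circ> q) i) \<circ> k)" if "strict_mono k" for k
  proof -
    have "dom_along \<G> H (\<sigma> n \<circ> q \<circ> k)"
      using H(2)[OF strict_mono_o[OF shift that]] by (simp add: q_def comp_assoc)
    from dom_along_scale[OF this, of "-1"] show ?thesis by (simp add: comp_def X.scale_minus_left)
  qed
  have rest: "dom_along (\<H> n) 1 ((\<lambda>i. - (\<tau> (q i) - \<sigma> (Suc n) (q i))) \<circ> k)" if k: "strict_mono k" for k
  proof -
    have mem: "(\<lambda>i. \<tau> i - \<sigma> (Suc n) i) \<in> R" by (rule diff_mem[OF \<tau>(1) \<sigma>])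
    have "2 * c (Suc n) \<le> 1 / K n" using c_K[of n] by simp
    then have "nrm (\<lambda>i. \<tau> i - \<sigma> (Suc n) i) \<le> 1 / K n" by (rule order_trans[OF \<tau>(2)])
    then have "K n * nrm (\<lambda>i. - (\<tau> i - \<sigma> (Suc n) i)) \<le> 1"
      using nrm_minus[OF mem] K[of n] by (simp add: field_simps)
    then have "dom_along (\<H> n) 1 ((\<lambda>i. - (\<tau> i - \<sigma> (Suc n) i)) \<circ> (q \<circ> k))"
      using bound[of n] K[of n] nrm_minus[OF mem] strict_mono_o[OF q k]
      by (intro dom_along_small[where K = "K n"]) auto
    then show ?thesis by (simp add: comp_def)
  qed
  have tail: "dom_along (\<H> n) E x" if "dom_along \<G> E x" for E x
    using dom_along_tail[OF spread[OF \<H>] _ that] tail[OF \<H>] by metis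
  have "dom_along \<G> (r * (real n + H)) (\<lambda>i. (\<tau> \<circ> q) i + - (\<sigma> n \<circ> q) i)"
    using H(1) by (intro dom_along_add \<G> sum head) auto
  then have "dom_along (\<H> n) (r * (r * (real n + H) + 1))
      (\<lambda>i. ((\<tau> \<circ> q) i + - (\<sigma> n \<circ> q) i) + - (\<tau> (q i) - \<sigma> (Suc n) (q i)))"
    by (rule dom_along_add[OF spread[OF \<H>] tail _ rest]) (use H(1) r0 in auto)
  also have "(\<lambda>i. ((\<tau> \<circ> q) i + - (\<sigma> n \<circ> q) i) + - (\<tau> (q i) - \<sigma> (Suc n) (q i))) =
      (\<lambda>i. c n *\<^sub>R (\<rho> n \<circ> q) i)"
    by (auto simp: \<sigma>_Suc)
  finally have "dom_along (\<H> n) (norm (of_real (inverse (c n)) :: 'k) * (r * (r * (real n + H) + 1)))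
      (\<lambda>i. smulX (of_real (inverse (c n))) (c n *\<^sub>R (\<rho> n \<circ> q) i))"
    by (rule dom_along_scale)
  then have "dom_along (\<H> n) (r * (r * (real n + H) + 1) / c n) (\<rho> n \<circ> q)"
    using c[of n] by (simp only: X.scale_of_real norm_of_real) (simp add: comp_def divide_inverse ac_simps)
  then show False using dom_along_subseq[OF q] H(3) by blast
qed

section \<open>Approximation by families of lower rank\<close>

text \<open>
  For each \<open>n\<close>, some subsequence is good for the family at \<open>fs \<xi> n\<close>; choose these nested and take the
  diagonal \<open>D\<close>. From the \<open>n\<close>-th term on, \<open>D\<close> is a subsequence of the \<open>n\<close>-th choice, and the members of
  the \<open>\<xi>\<close>-th family are the sets from \<open>n\<close> on belonging to the family at \<open>fs \<xi> n\<close>, for some \<open>n\<close>. The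
  index sequences in the basis are not nested; they are replaced by a common one to their right.
\<close>

lemma dom_along_limit:
  assumes \<xi>: "limit_ord \<xi>" and C: "0 \<le> C"
    and low: "\<And>n k. strict_mono k \<Longrightarrow> dom_along (fine_schreier fs (Countable_ord (fs \<xi> n))) C (x \<circ> k)"
  shows "dom_along (fine_schreier fs (Countable_ord \<xi>)) (r * C) x"
proof -
  define \<F> where "\<F> n = fine_schreier fs (Countable_ord (fs \<xi> n))" for n
  define P where "P n s \<longleftrightarrow> strict_mono (fst s) \<and> strict_mono (snd s) \<and>
      (\<forall>F\<in>\<F> n. dom_on C (x \<circ> fst s) (g \<circ> snd s) F)" for n and s :: "(nat \<Rightarrow> nat) \<times> (nat \<Rightarrow> nat)"
  have extend: "\<exists>s'. P n s' \<and> (\<exists>N. strict_mono N \<and> fst s' = M \<circ> N)" if M: "strict_mono M" for n and M :: "nat \<Rightarrow> nat"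
  proof -
    obtain N L where "strict_mono N" "strict_mono L" "\<forall>F\<in>\<F> n. dom_on C (x \<circ> M \<circ> N) (g \<circ> L) F"
      using low[OF M, of n] unfolding dom_along_def \<F>_def by blast
    then have "P n (M \<circ> N, L)" using strict_mono_o[OF M] by (auto simp: P_def comp_assoc)
    then show ?thesis using \<open>strict_mono N\<close> by (metis fst_conv)
  qed
  have "\<exists>s. \<forall>n. P n (s n) \<and> (\<exists>N. strict_mono N \<and> fst (s (Suc n)) = fst (s n) \<circ> N)"
  proof (rule dependent_nat_choice)
    show "\<exists>s. P 0 s" using extend[OF strict_mono_id] by blast
    show "\<exists>s'. P (Suc n) s' \<and> (\<exists>N. strict_mono N \<and> fst s' = fst s \<circ> N)" if "P n s" for s n
      using extend[of "fst s"] that by (simp add: P_def)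
  qed
  then obtain s where s: "\<And>n. P n (s n)" "\<And>n. \<exists>N. strict_mono N \<and> fst (s (Suc n)) = fst (s n) \<circ> N"
    by blast
  define M L where "M n = fst (s n)" and "L n = snd (s n)" for n
  have M: "strict_mono (M n)" and L: "strict_mono (L n)"
    and dom: "\<forall>F\<in>\<F> n. dom_on C (x \<circ> M n) (g \<circ> L n) F" for n
    using s(1)[of n] by (auto simp: P_def M_def L_def)
  obtain D where D: "strict_mono D" and "\<And>n. \<exists>h. strict_mono h \<and> (\<forall>i\<ge>n. D i = M n (h i))"
    using diagonal_sequence[of M] M s(2) unfolding M_def by blast
  then obtain h where h: "\<And>n. strict_mono (h n)" "\<And>n i. i \<ge> n \<Longrightarrow> D i = M n (h n i)"
    by metis
  \<comment> \<open>At place \<open>i\<close> only the index sequences with \<open>n \<le> i\<close> compete, so a finite sum bounds them.\<close>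
  define J where "J i = (\<Sum>j\<le>i. Suc (\<Sum>n\<le>j. L n (h n j)))" for i
  have J: "strict_mono J" by (simp add: strict_mono_Suc_iff J_def)
  have J_ge: "L n (h n i) \<le> J i" if "n \<le> i" for n i
  proof -
    have "L n (h n i) \<le> (\<Sum>n\<le>i. L n (h n i))" using that by (intro member_le_sum) auto
    also have "\<dots> \<le> Suc (\<Sum>n\<le>i. L n (h n i))" by simp
    also have "\<dots> \<le> J i"
      unfolding J_def by (rule member_le_sum[of i _ "\<lambda>j. Suc (\<Sum>n\<le>j. L n (h n j))"]) auto
    finally show ?thesis .
  qed
  have "dom_on (r * C) (x \<circ> D) (g \<circ> J) F" if F: "F \<in> fine_schreier fs (Countable_ord \<xi>)" for F
  proof -
    obtain n where n: "\<forall>k\<in>F. n \<le> k" "F \<in> \<F> n"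
      using F unfolding fine_schreier_limit[OF \<xi>] \<F>_def by blast
    have "dom_on C (x \<circ> M n \<circ> h n) (g \<circ> L n \<circ> h n) F"
      by (rule dom_on_spread[OF h(1) _ dom n(2)]) (simp only: \<F>_def spreading_fine_schreier)
    then have "dom_on C (x \<circ> D) (g \<circ> (L n \<circ> h n)) F"
      by (rule dom_on_cong[rotated 2]) (use n h in auto)
    then show ?thesis
      using C strict_mono_o[OF L h(1), of n] J
      by (rule dom_on_right) (use n J_ge in auto)
  qed
  then show ?thesis using D J unfolding dom_along_def by blast
qed

text \<open>
  The tree of dominated finite sequences contains a copy of every fine Schreier family, so its rank
  is at least \<open>\<omega>\<^sub>1\<close>; being a tree on a countable set, it has an infinite branch. In detail, a node is
  kept as long as it can be continued along the \<open>\<xi>\<close>-th family for every countable \<open>\<xi>\<close>. A continuation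
  along the family at \<open>succ_ord \<xi>\<close> gives a child with a continuation along the \<open>\<xi>\<close>-th one, and since
  there are only countably many children, one of them serves all \<open>\<xi>\<close>.
\<close>

lemma dom_along_finite_sets:
  assumes fs: "fundamental_sequences fs"
    and low: "\<And>\<xi>. dom_along (fine_schreier fs (Countable_ord \<xi>)) C x"
  shows "dom_along {F. finite F} C x"
proof -
  \<comment> \<open>The node is the restriction of \<open>p\<close> to \<open>{..<n}\<close>; the values of \<open>p\<close> beyond are arbitrary.\<close>
  define E where "E n p \<xi> \<longleftrightarrow> (\<exists>M L. strict_mono M \<and> strict_mono L \<and> (\<forall>i<n. p i = (M i, L i)) \<and>
      (\<forall>F. fine_schreier_mem fs \<xi> F \<longrightarrow> (\<forall>i\<in>F. n \<le> i) \<longrightarrow> dom_on C (x \<circ> M) (g \<circ> L) ({..<n} \<union> F)))"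
    for n and p :: "nat \<Rightarrow> nat \<times> nat" and \<xi>
  have down: "E n p \<eta>" if E: "E n p \<xi>" and le: "\<eta> \<le> \<xi>" for n p \<xi> \<eta>
  proof -
    obtain M L where w: "strict_mono M" "strict_mono L" "\<forall>i<n. p i = (M i, L i)"
      "\<And>F. fine_schreier_mem fs \<xi> F \<Longrightarrow> \<forall>i\<in>F. n \<le> i \<Longrightarrow> dom_on C (x \<circ> M) (g \<circ> L) ({..<n} \<union> F)"
      using E unfolding E_def by blast
    obtain m where m: "\<And>F. fine_schreier_mem fs \<eta> F \<Longrightarrow> \<forall>i\<in>F. m \<le> i \<Longrightarrow> fine_schreier_mem fs \<xi> F"
      using fine_schreier_mem_almost_mono[OF fs le] by blast
    define h where "h i = (if i < n then i else i + m)" for i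
    have h: "strict_mono h" by (auto simp: strict_mono_Suc_iff h_def)
    have "dom_on C (x \<circ> M \<circ> h) (g \<circ> L \<circ> h) ({..<n} \<union> F)"
      if F: "fine_schreier_mem fs \<eta> F" "\<forall>i\<in>F. n \<le> i" for F
    proof (rule dom_on_image)
      show "inj_on h ({..<n} \<union> F)" using strict_mono_imp_inj_on[OF h] inj_on_subset by blast
      have "\<forall>i\<in>h ` F. m \<le> i \<and> n \<le> i" using F(2) by (auto simp: h_def)
      then have "dom_on C (x \<circ> M) (g \<circ> L) ({..<n} \<union> h ` F)"
        using m fine_schreier_mem_spread[OF F(1) h] by (intro w(4)) auto
      moreover have "h ` ({..<n} \<union> F) = {..<n} \<union> h ` F" by (force simp: h_def image_Un)
      ultimately show "dom_on C (x \<circ> M) (g \<circ> L) (h ` ({..<n} \<union> F))" by simp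
    qed
    moreover have "\<forall>i<n. p i = ((M \<circ> h) i, (L \<circ> h) i)" using w(3) by (simp add: h_def)
    ultimately show ?thesis
      using strict_mono_o[OF w(1) h] strict_mono_o[OF w(2) h] unfolding E_def comp_assoc by blast
  qed
  have step: "\<exists>a. E (Suc n) (p(n := a)) \<xi>" if E: "E n p (succ_ord \<xi>)" for n p \<xi>
  proof -
    obtain M L where w: "strict_mono M" "strict_mono L" "\<forall>i<n. p i = (M i, L i)"
      "\<And>F. fine_schreier_mem fs (succ_ord \<xi>) F \<Longrightarrow> \<forall>i\<in>F. n \<le> i \<Longrightarrow> dom_on C (x \<circ> M) (g \<circ> L) ({..<n} \<union> F)"
      using E unfolding E_def by blast
    have "dom_on C (x \<circ> M) (g \<circ> L) ({..<Suc n} \<union> F)"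
      if F: "fine_schreier_mem fs \<xi> F" "\<forall>i\<in>F. Suc n \<le> i" for F
    proof -
      have "fine_schreier_mem fs (succ_ord \<xi>) (insert n F)"
        by (rule fine_schreier_mem.succ_insert[OF F(1)]) (use F in auto)
      moreover have "{..<Suc n} \<union> F = {..<n} \<union> insert n F" by auto
      ultimately show ?thesis using w(4)[of "insert n F"] F(2) by fastforce
    qed
    then have "E (Suc n) (p(n := (M n, L n))) \<xi>"
      using w(1-3) unfolding E_def by (intro exI[of _ M] exI[of _ L]) (auto simp: less_Suc_eq)
    then show ?thesis ..
  qed
  have "\<exists>p. \<forall>n. (\<forall>\<xi>. E n (p n) \<xi>) \<and> (\<exists>a. p (Suc n) = (p n)(n := a))"
  proof (rule dependent_nat_choice)
    show "\<exists>p. \<forall>\<xi>. E 0 p \<xi>" using low unfolding E_def dom_along_def by auto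
  next
    fix p n assume "\<forall>\<xi>. E n p \<xi>"
    then have "\<exists>a. E (Suc n) (p(n := a)) \<xi>" for \<xi>
      using step by blast
    then have "\<exists>a. \<forall>\<xi>. E (Suc n) (p(n := a)) \<xi>"
      using all_lt_countable_ord_swap[of "\<lambda>a. E (Suc n) (p(n := a))"] down by blast
    then show "\<exists>q. (\<forall>\<xi>. E (Suc n) q \<xi>) \<and> (\<exists>a. q = p(n := a))" by blast
  qed
  then obtain p where p: "\<And>n \<xi>. E n (p n) \<xi>" "\<And>n. \<exists>a. p (Suc n) = (p n)(n := a)" by blast
  have p_eq: "p (Suc i + k) i = p (Suc i) i" for i k
  proof (induction k)
    case (Suc k)
    then show ?case using p(2)[of "Suc i + k"] by auto
  qed simp
  define M L where "M i = fst (p (Suc i) i)" and "L i = snd (p (Suc i) i)" for i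
  have p_pair: "p n i = (M i, L i)" if "i < n" for n i
    using p_eq[of i "n - Suc i"] that by (simp add: M_def L_def)
  have initial: "(\<forall>i j. i < j \<longrightarrow> j < n \<longrightarrow> M i < M j \<and> L i < L j) \<and> dom_on C (x \<circ> M) (g \<circ> L) {..<n}" for n
  proof -
    obtain M' L' where w: "strict_mono M'" "strict_mono L'" "\<forall>i<n. p n i = (M' i, L' i)"
      "\<And>F. fine_schreier_mem fs zero_ord F \<Longrightarrow> \<forall>i\<in>F. n \<le> i \<Longrightarrow> dom_on C (x \<circ> M') (g \<circ> L') ({..<n} \<union> F)"
      using p(1)[of n zero_ord] unfolding E_def by blast
    have eq: "M i = M' i" "L i = L' i" if "i < n" for i
      using w(3) p_pair[OF that] that by auto
    have "dom_on C (x \<circ> M') (g \<circ> L') {..<n}" using w(4)[OF fine_schreier_mem.zero] by simp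
    then have "dom_on C (x \<circ> M) (g \<circ> L) {..<n}"
      by (rule dom_on_cong[rotated 2]) (simp_all add: eq)
    then show ?thesis using eq w(1,2) by (auto simp: strict_mono_less)
  qed
  have "strict_mono M" "strict_mono L"
    using initial by (auto simp: strict_mono_def)
  moreover have "dom_on C (x \<circ> M) (g \<circ> L) F" if F: "finite F" for F
  proof -
    obtain n where n: "F \<subseteq> {..<n}" using F finite_nat_iff_bounded by blast
    show ?thesis
      by (rule dom_on_subset[OF _ n finite_lessThan]) (use initial[of n] in blast)
  qed
  ultimately show ?thesis unfolding dom_along_def by blast
qed

section \<open>Uniform domination along the fine Schreier families\<close>

lemma dom_along_succ:
  assumes x: "x \<in> B" and C: "0 \<le> C" and dom: "dom_along (fine_schreier fs (Countable_ord \<xi>)) C x"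
  shows "dom_along (fine_schreier fs (Countable_ord (succ_ord \<xi>))) (C + 1) x"
proof -
  obtain M L where w: "strict_mono M" "strict_mono L"
    "\<forall>F\<in>fine_schreier fs (Countable_ord \<xi>). dom_on C (x \<circ> M) (g \<circ> L) F"
    using dom unfolding dom_along_def by blast
  have "dom_on (C + 1) (x \<circ> M) (g \<circ> L) F" if F: "F \<in> fine_schreier fs (Countable_ord (succ_ord \<xi>))" for F
  proof -
    consider "F = {}" | n G where "F = insert n G" "\<forall>k\<in>G. n < k" "G \<in> fine_schreier fs (Countable_ord \<xi>)"
      using F unfolding fine_schreier_succ by auto
    then show ?thesis
    proof cases
      case 1
      then show ?thesis by (simp add: dom_on_def)
    next
      case 2
      then show ?thesis
        using w C finite_fine_schreier[OF 2(3)] X.ball_subset[OF x]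
        by (simp only: 2(1)) (intro dom_on_insert, auto)
    qed
  qed
  then show ?thesis using w unfolding dom_along_def by blast
qed

text \<open>
  Induction on \<open>\<xi>\<close>. Adding one element to the sets costs at most \<open>1\<close>, and at a limit ordinal the
  families along the fundamental sequence are uniformly bounded by induction and approximate the
  \<open>\<xi>\<close>-th one.
\<close>

lemma countable_uniform:
  assumes fs: "fundamental_sequences fs"
    and pointwise: "\<And>x. x \<in> R \<Longrightarrow> \<exists>C. dom_along (fine_schreier fs (Countable_ord \<xi>)) C x"
  shows "\<exists>K. \<forall>x\<in>B. dom_along (fine_schreier fs (Countable_ord \<xi>)) K x"
  using pointwise
proof (induction \<xi> rule: less_induct)
  case (less \<xi>)
  consider "\<xi> = zero_ord" | \<xi>' where "\<xi> = succ_ord \<xi>'" | "limit_ord \<xi>"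
    unfolding limit_ord_def by blast
  then show ?case
  proof cases
    case 1
    have "dom_along {{}} 0 x" for x
      unfolding dom_along_def dom_on_def by (intro exI[of _ id]) (simp add: strict_mono_id)
    then show ?thesis using 1 by (simp only: fine_schreier_zero) blast
  next
    case (2 \<xi>')
    have "\<exists>C. dom_along (fine_schreier fs (Countable_ord \<xi>')) C x" if x: "x \<in> R" for x
    proof -
      obtain C where "dom_along (fine_schreier fs (Countable_ord \<xi>)) C x" using less.prems x by blast
      then have "dom_along (fine_schreier fs (Countable_ord \<xi>')) C x"
        by (rule dom_along_tail[OF spreading_fine_schreier, rotated])
          (auto simp: 2 intro: fine_schreier_mem_succ)
      then show ?thesis ..
    qed
    then obtain K where "\<forall>x\<in>B. dom_along (fine_schreier fs (Countable_ord \<xi>')) K x"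
      using less.IH[of \<xi>'] less_succ_ord[of \<xi>'] 2 by auto
    then have "\<forall>x\<in>B. dom_along (fine_schreier fs (Countable_ord \<xi>')) (max 0 K) x"
      using dom_along_mono by fastforce
    then show ?thesis using dom_along_succ 2 by (metis max.cobounded1)
  next
    case 3
    define \<F> where "\<F> n = fine_schreier fs (Countable_ord (fs \<xi> n))" for n
    have tail: "F \<in> fine_schreier fs (Countable_ord \<xi>)" if "F \<in> \<F> n" "\<forall>i\<in>F. n \<le> i" for n F
      using that unfolding fine_schreier_limit[OF 3] \<F>_def by blast
    show ?thesis
    proof (rule uniform_boundedness[OF spreading_fine_schreier, of "range \<F>"])
      show "spreading \<H>" if "\<H> \<in> range \<F>" for \<H>
        using that spreading_fine_schreier unfolding \<F>_def by blast
      show "\<exists>n. \<forall>F\<in>\<H>. (\<forall>i\<in>F. n \<le> i) \<longrightarrow> F \<in> fine_schreier fs (Countable_ord \<xi>)"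
        if "\<H> \<in> range \<F>" for \<H>
        using that tail by blast
      show "\<exists>K. \<forall>x\<in>B. dom_along \<H> K x" if \<H>: "\<H> \<in> range \<F>" for \<H>
      proof -
        obtain n where n: "\<H> = \<F> n" using \<H> by blast
        have "fs \<xi> n < \<xi>" using fs 3 by (simp add: fundamental_sequences_def)
        moreover have "\<exists>C. dom_along (\<F> n) C x" if x: "x \<in> R" for x
        proof -
          obtain C where "dom_along (fine_schreier fs (Countable_ord \<xi>)) C x" using less.prems x by blast
          then have "dom_along (\<F> n) C x"
            by (rule dom_along_tail[of "\<F> n" n, rotated 2])
              (simp_all only: \<F>_def spreading_fine_schreier tail[unfolded \<F>_def])
          then show ?thesis ..
        qed
        ultimately show ?thesis using less.IH n unfolding \<F>_def by blast
      qed
      show "dom_along (fine_schreier fs (Countable_ord \<xi>)) (r * C) x"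
        if "0 < C" "\<And>\<H> k. \<H> \<in> range \<F> \<Longrightarrow> strict_mono k \<Longrightarrow> dom_along \<H> C (x \<circ> k)" for x C
        using that(1) that(2)[OF rangeI] by (intro dom_along_limit[OF 3]) (auto simp: \<F>_def)
    qed (rule less.prems)
  qed
qed

text \<open>
  The case \<open>\<omega>\<^sub>1\<close> is a limit step over all countable ordinals, with a different approximation
  property.
\<close>

lemma uniform_domination:
  assumes fs: "fundamental_sequences fs"
    and pointwise: "\<And>x. x \<in> R \<Longrightarrow> \<exists>C. dom_along (fine_schreier fs \<zeta>) C x"
  shows "\<exists>K. \<forall>x\<in>B. dom_along (fine_schreier fs \<zeta>) K x"
proof (cases \<zeta>)
  case (Countable_ord \<xi>)
  then show ?thesis using countable_uniform[OF fs] pointwise by blast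
next
  case Omega1
  define \<F> where "\<F> \<xi> = fine_schreier fs (Countable_ord \<xi>)" for \<xi>
  have fin: "F \<in> fine_schreier fs \<zeta>" if "F \<in> \<F> \<xi>" for F \<xi>
    using that finite_fine_schreier[of F fs "Countable_ord \<xi>"] by (simp add: Omega1 \<F>_def)
  show ?thesis
  proof (rule uniform_boundedness[OF spreading_fine_schreier, of "range \<F>"])
    show "spreading \<H>" if "\<H> \<in> range \<F>" for \<H>
      using that spreading_fine_schreier unfolding \<F>_def by blast
    show "\<exists>n. \<forall>F\<in>\<H>. (\<forall>i\<in>F. n \<le> i) \<longrightarrow> F \<in> fine_schreier fs \<zeta>" if "\<H> \<in> range \<F>" for \<H>
      using that fin by blast
    show "\<exists>K. \<forall>x\<in>B. dom_along \<H> K x" if \<H>: "\<H> \<in> range \<F>" for \<H>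
    proof -
      obtain \<xi> where \<xi>: "\<H> = \<F> \<xi>" using \<H> by blast
      have "\<exists>C. dom_along (\<F> \<xi>) C x" if x: "x \<in> R" for x
      proof -
        obtain C where "dom_along (fine_schreier fs \<zeta>) C x" using pointwise x by blast
        then have "dom_along (\<F> \<xi>) C x"
          by (rule dom_along_tail[of "\<F> \<xi>" 0, rotated 2])
            (simp_all only: \<F>_def spreading_fine_schreier fin[unfolded \<F>_def])
        then show ?thesis ..
      qed
      then show ?thesis using countable_uniform[OF fs] \<xi> unfolding \<F>_def by blast
    qed
    show "dom_along (fine_schreier fs \<zeta>) (r * C) x"
      if C: "0 < C" and low: "\<And>\<H> k. \<H> \<in> range \<F> \<Longrightarrow> strict_mono k \<Longrightarrow> dom_along \<H> C (x \<circ> k)" for x C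
    proof -
      have "dom_along {F. finite F} C x"
        using low[OF rangeI strict_mono_id] by (intro dom_along_finite_sets[OF fs]) (simp add: \<F>_def)
      then show ?thesis
        using Omega1 C r_ge_1 dom_along_mono[of _ C x "r * C"] by (simp add: mult_le_cancel_right1)
    qed
  qed (rule pointwise)
qed

section \<open>The quantities \<open>\<Gamma>\<close>\<close>

text \<open>
  The coefficients indexed by positions in the list and those indexed by elements of \<open>F\<close> correspond
  to each other under the increasing enumeration of \<open>F\<close>.
\<close>

lemma dominated_pair_seq:
  assumes "finite F"
  shows "dominated smulX smulG C (map (\<lambda>(m, l). x m) (pair_seq M L F)) (map (\<lambda>(m, l). g l) (pair_seq M L F))
    \<longleftrightarrow> dom_on C (x \<circ> enumerate M) (g \<circ> enumerate L) F"
proof -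
  let ?s = "sorted_list_of_set F"
  have bij: "bij_betw (\<lambda>n. ?s ! n) {..<length ?s} F"
    using bij_betw_nth[of ?s "{..<length ?s}" F] assms by simp
  define e where "e = the_inv_into {..<length ?s} (\<lambda>n. ?s ! n)"
  have e: "e (?s ! n) = n" if "n < length ?s" for n
    using bij that unfolding e_def bij_betw_def by (simp add: the_inv_into_f_f)
  have sumX: "(\<Sum>n<length ?s. smulX (b (?s ! n)) (x (enumerate M (?s ! n)))) =
      (\<Sum>i\<in>F. smulX (b i) (x (enumerate M i)))" for b
    using sum.reindex_bij_betw[OF bij, of "\<lambda>i. smulX (b i) (x (enumerate M i))"] .
  have sumG: "(\<Sum>n<length ?s. smulG (b (?s ! n)) (g (enumerate L (?s ! n)))) =
      (\<Sum>i\<in>F. smulG (b i) (g (enumerate L i)))" for b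
    using sum.reindex_bij_betw[OF bij, of "\<lambda>i. smulG (b i) (g (enumerate L i))"] .
  have "dominated smulX smulG C (map (\<lambda>(m, l). x m) (pair_seq M L F)) (map (\<lambda>(m, l). g l) (pair_seq M L F))
    \<longleftrightarrow> (\<forall>a. norm (\<Sum>n<length ?s. smulX (a n) (x (enumerate M (?s ! n))))
        \<le> C * norm (\<Sum>n<length ?s. smulG (a n) (g (enumerate L (?s ! n)))))"
    by (simp add: dominated_def pair_seq_def del: length_sorted_list_of_set cong: sum.cong_simp)
  also have "\<dots> \<longleftrightarrow> dom_on C (x \<circ> enumerate M) (g \<circ> enumerate L) F"
  proof
    assume *: "\<forall>a. norm (\<Sum>n<length ?s. smulX (a n) (x (enumerate M (?s ! n))))
        \<le> C * norm (\<Sum>n<length ?s. smulG (a n) (g (enumerate L (?s ! n))))"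
    show "dom_on C (x \<circ> enumerate M) (g \<circ> enumerate L) F"
      unfolding dom_on_def
    proof
      fix b :: "nat \<Rightarrow> 'k"
      show "norm (\<Sum>i\<in>F. smulX (b i) ((x \<circ> enumerate M) i))
          \<le> C * norm (\<Sum>i\<in>F. smulG (b i) ((g \<circ> enumerate L) i))"
        using *[rule_format, of "\<lambda>n. b (?s ! n)"] by (simp only: sumX sumG o_def)
    qed
  next
    assume *: "dom_on C (x \<circ> enumerate M) (g \<circ> enumerate L) F"
    show "\<forall>a. norm (\<Sum>n<length ?s. smulX (a n) (x (enumerate M (?s ! n))))
        \<le> C * norm (\<Sum>n<length ?s. smulG (a n) (g (enumerate L (?s ! n))))"
    proof
      fix a :: "nat \<Rightarrow> 'k"
      have "norm (\<Sum>n<length ?s. smulX (a (e (?s ! n))) (x (enumerate M (?s ! n))))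
        \<le> C * norm (\<Sum>n<length ?s. smulG (a (e (?s ! n))) (g (enumerate L (?s ! n))))"
        using *[unfolded dom_on_def o_def, rule_format, of "\<lambda>i. a (e i)"]
        unfolding sumX[of "\<lambda>i. a (e i)"] sumG[of "\<lambda>i. a (e i)"] .
      then show "norm (\<Sum>n<length ?s. smulX (a n) (x (enumerate M (?s ! n))))
        \<le> C * norm (\<Sum>n<length ?s. smulG (a n) (g (enumerate L (?s ! n))))"
        by (simp add: e del: length_sorted_list_of_set cong: sum.cong_simp)
    qed
  qed
  finally show ?thesis .
qed

lemma pair_seq_in_dom_tree:
  assumes "infinite M" "infinite L" "finite F"
  shows "pair_seq M L F \<in> dom_tree smulX smulG g x C \<longleftrightarrow> dom_on C (x \<circ> enumerate M) (g \<circ> enumerate L) F"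
proof (cases "F = {}")
  case True
  then show ?thesis by (simp add: pair_seq_def dom_tree_def dom_on_def)
next
  case False
  have sorted: "sorted_wrt (<) (map (enumerate A) (sorted_list_of_set F))" if "infinite A" for A :: "nat set"
    unfolding sorted_wrt_map using that
    by (intro sorted_wrt_mono_rel[OF _ strict_sorted_list_of_set]) (auto intro: enumerate_mono)
  have "map fst (pair_seq M L F) = map (enumerate M) (sorted_list_of_set F)"
    "map snd (pair_seq M L F) = map (enumerate L) (sorted_list_of_set F)"
    by (simp_all add: pair_seq_def comp_def)
  moreover have "pair_seq M L F \<noteq> []"
    using False assms(3) by (simp add: pair_seq_def)
  ultimately show ?thesis
    by (simp only: dom_tree_def insert_iff mem_Collect_eq sorted[OF assms(1)] sorted[OF assms(2)]
        dominated_pair_seq[OF assms(3)] simp_thms)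
qed

lemma dom_along_iff:
  assumes "\<And>F. F \<in> \<F> \<Longrightarrow> finite F"
  shows "dom_along \<F> C x \<longleftrightarrow> (\<exists>M L. infinite M \<and> infinite L \<and>
    {pair_seq M L F |F. F \<in> \<F>} \<subseteq> dom_tree smulX smulG g x C)"
proof -
  have "(\<exists>M L. infinite M \<and> infinite L \<and> {pair_seq M L F |F. F \<in> \<F>} \<subseteq> dom_tree smulX smulG g x C) \<longleftrightarrow>
    (\<exists>M L. infinite M \<and> infinite L \<and> (\<forall>F\<in>\<F>. dom_on C (x \<circ> enumerate M) (g \<circ> enumerate L) F))"
    using pair_seq_in_dom_tree[OF _ _ assms] by (intro ex_cong1 conj_cong refl) (auto simp: subset_iff)
  also have "\<dots> \<longleftrightarrow> dom_along \<F> C x"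
  proof
    assume "\<exists>M L. infinite M \<and> infinite L \<and> (\<forall>F\<in>\<F>. dom_on C (x \<circ> enumerate M) (g \<circ> enumerate L) F)"
    then show "dom_along \<F> C x" unfolding dom_along_def using strict_mono_enumerate by blast
  next
    assume "dom_along \<F> C x"
    then obtain M L where w: "strict_mono M" "strict_mono L" "\<forall>F\<in>\<F>. dom_on C (x \<circ> M) (g \<circ> L) F"
      unfolding dom_along_def by blast
    then have "infinite (range M)" "infinite (range L)"
      by (auto simp: range_inj_infinite strict_mono_imp_inj_on)
    then show "\<exists>M L. infinite M \<and> infinite L \<and> (\<forall>F\<in>\<F>. dom_on C (x \<circ> enumerate M) (g \<circ> enumerate L) F)"
      using w by (intro exI[of _ "range M"] exI[of _ "range L"]) (simp add: enumerate_range_strict_mono)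
  qed
  finally show ?thesis by blast
qed

lemma Gamma_at_eq:
  "Gamma_at smulX smulG g fs \<xi> x = Inf {ereal C |C. 0 < C \<and> dom_along (fine_schreier fs \<xi>) C x}"
proof -
  have "dom_along (fine_schreier fs \<xi>) C x \<longleftrightarrow> (\<exists>M L. infinite M \<and> infinite L \<and>
      {pair_seq M L F |F. F \<in> fine_schreier fs \<xi>} \<subseteq> dom_tree smulX smulG g x C)" for C
    by (rule dom_along_iff) (rule finite_fine_schreier)
  then show ?thesis by (simp only: Gamma_at_def)
qed

lemma Gamma_at_finite_imp:
  assumes "Gamma_at smulX smulG g fs \<xi> x < \<infinity>"
  shows "\<exists>C. dom_along (fine_schreier fs \<xi>) C x"
  using assms unfolding Gamma_at_eq Inf_less_iff by blast

lemma Gamma_sup_finite: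
  assumes fs: "fundamental_sequences fs"
    and pointwise: "\<And>x. x \<in> R \<Longrightarrow> Gamma_at smulX smulG g fs \<zeta> x < \<infinity>"
  shows "Gamma_sup smulX smulG g fs R nrm \<zeta> < \<infinity>"
proof -
  obtain K where K: "\<forall>x\<in>B. dom_along (fine_schreier fs \<zeta>) K x"
    using uniform_domination[OF fs Gamma_at_finite_imp[OF pointwise]] by blast
  define K' where "K' = max 1 K"
  have K': "0 < K'" "\<forall>x\<in>B. dom_along (fine_schreier fs \<zeta>) K' x"
    using K dom_along_mono by (fastforce simp: K'_def)+
  have "Gamma_at smulX smulG g fs \<zeta> x \<le> ereal K'" if "x \<in> B" for x
    unfolding Gamma_at_eq using K' that by (intro Inf_lower) auto
  then have "Gamma_sup smulX smulG g fs R nrm \<zeta> \<le> ereal K'"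
    unfolding Gamma_sup_def by (rule SUP_least)
  then show ?thesis by (rule order.strict_trans1) simp
qed

end

theorem theorem3p1:
  fixes r :: real
    and scaleG :: "'k::real_normed_field \<Rightarrow> 'g::banach \<Rightarrow> 'g"
    and g :: "nat \<Rightarrow> 'g"
    and scaleX :: "'k \<Rightarrow> 'x::banach \<Rightarrow> 'x"
    and R :: "(nat \<Rightarrow> 'x) set"
    and nrm :: "(nat \<Rightarrow> 'x) \<Rightarrow> real"
    and fs :: "countable_ord \<Rightarrow> nat \<Rightarrow> countable_ord"
    and \<zeta> :: ord_upto_omega1
  assumes "1 \<le> r"
    and "normed_space_over scaleG"
    and "schauder_basis scaleG g"
    and "\<And>n. norm (g n) = 1"
    and "bimonotone scaleG g"
    and "right_dominant r scaleG g"
    and "subsequential_space scaleX R nrm"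
    and "fundamental_sequences fs"
    and "\<And>\<rho>. \<rho> \<in> R \<Longrightarrow> Gamma_at scaleX scaleG g fs \<zeta> \<rho> < \<infinity>"
  shows "Gamma_sup scaleX scaleG g fs R nrm \<zeta> < \<infinity>"
proof -
  interpret dominating_basis scaleX R nrm scaleG g r
    using assms by (simp add: dominating_basis_def dominating_basis_axioms_def)
  show ?thesis using assms by (intro Gamma_sup_finite)
qed

end
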